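(* For $0<b<2$ let $F_b:M_b\to M_b$ be the billiard map on the lemon table $\mathcal{Q}(b)$. Then there exists $\delta_0>0$ such that the set $\{b\in(1.5,\,1.5+\delta_0): h_{top}(F_b)=0\}$ has no limiting point in $(1.5,\,1.5+\delta_0)$.
   Context: For $0<b<2$, the lemon table $\mathcal{Q}(b)\subset\mathbb{R}^2$ is the intersection of two unit disks centered at $O_\ell=(0,0)$ and $O_r=(b,0)$, so that $b$ is the distance between the two centers. Its boundary consists of two circular arcs meeting at two corner points. Billiard map: parametrize $\partial\mathcal{Q}(b)$ by arc length $s$ (with the table on the left), writing $\gamma(s)\in\partial\mathcal{Q}(b)$ and $\dot\gamma(s)$ for the unit tangent vector. The phase space is $M_b=\partial\mathcal{Q}(b)\times[0,\pi]$; a point $(s,\theta)$ represents the trajectory starting at $\gamma(s)$ in the direction obtained by rotating $\dot\gamma(s)$ counterclockwise by the angle $\theta$. If $\gamma(s_1)$ is the next point where the trajectory meets $\partial\mathcal{Q}(b)$ and $\theta_1$ is the angle from $\dot\gamma(s_1)$ to the direction of the trajectory (after elastic reflection) at $\gamma(s_1)$, then $F_b(s,\theta)=(s_1,\theta_1)$. $h_{top}(F_b)$ denotes the topological entropy of the map $F_b$. *)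

theory Defs
  imports "HOL-Analysis.Analysis"
begin

section \<open>The lemon table\<close>

text \<open>The Euclidean plane is the type \<^typ>\<open>complex\<close>, so that rotating a vector counterclockwise
  by \<open>\<theta>\<close> is multiplication by \<open>cis \<theta>\<close>.  The centres are \<open>O\<^sub>\<ell> = 0\<close> and \<open>O\<^sub>r = b\<close>.\<close>

definition lemon_table :: "real \<Rightarrow> complex set" where
  "lemon_table b = cball 0 1 \<inter> cball (of_real b) 1"

definition lemon_corners :: "real \<Rightarrow> complex set" where
  "lemon_corners b = sphere 0 1 \<inter> sphere (of_real b) 1"

text \<open>The unit tangent vector at a boundary point other than a corner, pointing in the direction
  that has the table on the left.  The \<^emph>\<open>right\<close> boundary arc lies on the circle around \<open>O\<^sub>\<ell>\<close>, the
  \<^emph>\<open>left\<close> one on the circle around \<open>O\<^sub>r\<close>.  There is no tangent at a corner; the value there is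
  never used in the dynamics below.\<close>

definition lemon_tangent :: "real \<Rightarrow> complex \<Rightarrow> complex" where
  "lemon_tangent b p = (if p \<in> sphere 0 1 then \<i> * p else \<i> * (p - of_real b))"

text \<open>The arc-length parametrization \<open>\<gamma>\<close> of the boundary, counterclockwise from the lower corner,
  over one period \<open>0 \<le> s < 4 * arccos (b / 2)\<close>.  The lemmas below show that it is a bijection onto
  the boundary and that \<^const>\<open>lemon_tangent\<close> at \<open>\<gamma>(s)\<close> is its derivative.\<close>

definition lemon_curve :: "real \<Rightarrow> real \<Rightarrow> complex" where
  "lemon_curve b s = (let \<phi> = arccos (b / 2) in
     if s < 2 * \<phi> then cis (s - \<phi>) else of_real b - cis (s - 3 * \<phi>))"


section \<open>The billiard map\<close>

text \<open>A phase point is written \<open>(\<gamma>(s), \<theta>)\<close> instead of \<open>(s, \<theta>)\<close>.\<close>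

definition lemon_phase :: "real \<Rightarrow> (complex \<times> real) set" where
  "lemon_phase b = frontier (lemon_table b) \<times> {0..pi}"

definition next_hit :: "real \<Rightarrow> complex \<Rightarrow> complex \<Rightarrow> complex" where
  "next_hit b p v =
     p + of_real (LEAST t. 0 < t \<and> p + of_real t * v \<in> frontier (lemon_table b)) * v"

text \<open>Elastic reflection of a velocity in the line spanned by the unit vector \<open>\<tau>\<close>.\<close>

definition reflect_in :: "complex \<Rightarrow> complex \<Rightarrow> complex" where
  "reflect_in \<tau> v = \<tau>\<^sup>2 * cnj v"

text \<open>A trajectory with \<open>\<theta> \<in> {0, pi}\<close> is tangent to the boundary and never meets the table again;
  such points are fixed, which is the continuous extension of the map.  The value at a point based
  at a corner is meaningless.\<close>

definition lemon_map :: "real \<Rightarrow> complex \<times> real \<Rightarrow> complex \<times> real" where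
  "lemon_map b = (\<lambda>(p, \<theta>).
     if \<theta> = 0 \<or> \<theta> = pi then (p, \<theta>)
     else (let v = cis \<theta> * lemon_tangent b p;
               q = next_hit b p v;
               \<tau> = lemon_tangent b q
           in (q, Arg (reflect_in \<tau> v / \<tau>))))"

text \<open>The billiard map is not defined at the corners, so its orbits are those of the phase points
  whose forward trajectory never hits a corner.\<close>

definition lemon_domain :: "real \<Rightarrow> (complex \<times> real) set" where
  "lemon_domain b =
     {x \<in> lemon_phase b. \<forall>n. fst ((lemon_map b ^^ n) x) \<notin> lemon_corners b}"


section \<open>Topological entropy\<close>

text \<open>Bowen's definition for a map of a metric space, restricted to an invariant subset \<open>X\<close>.
  No continuity is required.  The inner quantity is nonincreasing in \<open>\<epsilon>\<close>, so the supremum over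
  \<open>\<epsilon> > 0\<close> is the limit for \<open>\<epsilon> \<rightarrow> 0\<close>.\<close>

definition separated_set ::
    "('a::metric_space \<Rightarrow> 'a) \<Rightarrow> 'a set \<Rightarrow> nat \<Rightarrow> real \<Rightarrow> 'a set \<Rightarrow> bool" where
  "separated_set F X n \<epsilon> E \<longleftrightarrow> finite E \<and> E \<subseteq> X \<and>
     (\<forall>x\<in>E. \<forall>y\<in>E. x \<noteq> y \<longrightarrow> (\<exists>k<n. dist ((F ^^ k) x) ((F ^^ k) y) > \<epsilon>))"

definition topological_entropy :: "('a::metric_space \<Rightarrow> 'a) \<Rightarrow> 'a set \<Rightarrow> ereal" where
  "topological_entropy F X =
     (SUP \<epsilon>\<in>{0<..}. limsup (\<lambda>n.
        SUP E\<in>{E. separated_set F X n \<epsilon> E}. ereal (ln (real (card E)) / real n)))"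

definition lemon_entropy :: "real \<Rightarrow> ereal" where
  "lemon_entropy b = topological_entropy (lemon_map b) (lemon_domain b)"


section \<open>Consistency of the definitions\<close>

lemma frontier_lemon_table:
  assumes "0 < b" "b < 2"
  shows "frontier (lemon_table b) =
    {p. cmod p \<le> 1 \<and> cmod (p - of_real b) \<le> 1 \<and> (cmod p = 1 \<or> cmod (p - of_real b) = 1)}"
proof -
  have cl: "closed (lemon_table b)"
    unfolding lemon_table_def by auto
  have "interior (lemon_table b) = ball 0 1 \<inter> ball (of_real b) 1"
    unfolding lemon_table_def by (simp add: interior_cball)
  then have "frontier (lemon_table b) = lemon_table b - ball 0 1 \<inter> ball (of_real b) 1"
    using cl by (simp add: frontier_def)
  also have "\<dots> = {p. cmod p \<le> 1 \<and> cmod (p - of_real b) \<le> 1 \<and>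
      (cmod p = 1 \<or> cmod (p - of_real b) = 1)}"
    unfolding lemon_table_def set_eq_iff Diff_iff Int_iff mem_cball mem_ball mem_Collect_eq
      dist_norm norm_minus_commute[of "of_real b"] diff_0 norm_minus_cancel
    by linarith
  finally show ?thesis .
qed

lemma arccos_half_bounds:
  assumes "0 < b" "b < 2"
  shows "0 < arccos (b / 2)" "arccos (b / 2) < pi / 2" "cos (arccos (b / 2)) = b / 2"
proof -
  have "arccos 1 < arccos (b / 2)" "arccos (b / 2) < arccos 0"
    using assms by (intro arccos_less_arccos; simp)+
  then show "0 < arccos (b / 2)" "arccos (b / 2) < pi / 2" by simp_all
  show "cos (arccos (b / 2)) = b / 2" using assms by (intro cos_arccos) simp_all
qed

lemma lemon_curve_right:
  assumes "s \<in> {0<..<2 * arccos (b / 2)}"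
  shows "lemon_curve b s \<in> sphere 0 1"
    and "(lemon_curve b has_vector_derivative lemon_tangent b (lemon_curve b s)) (at s)"
proof -
  define \<phi> where "\<phi> = arccos (b / 2)"
  have eq: "lemon_curve b t = cis (t - \<phi>)" if "t \<in> {0<..<2 * \<phi>}" for t
    using that by (simp add: lemon_curve_def \<phi>_def Let_def)
  have s: "s \<in> {0<..<2 * \<phi>}" using assms by (simp add: \<phi>_def)
  show 1: "lemon_curve b s \<in> sphere 0 1" using eq[OF s] by simp
  have "((\<lambda>t. cis (t - \<phi>)) has_vector_derivative \<i> * cis (s - \<phi>)) (at s)"
    unfolding has_vector_derivative_complex_iff
    by (auto intro!: derivative_eq_intros)
  moreover have "lemon_tangent b (lemon_curve b s) = \<i> * cis (s - \<phi>)"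
    using 1 eq[OF s] by (simp add: lemon_tangent_def)
  ultimately show "(lemon_curve b has_vector_derivative lemon_tangent b (lemon_curve b s)) (at s)"
    using has_vector_derivative_transform_within_open[of _ _ s "{0<..<2 * \<phi>}" "lemon_curve b"]
      eq s by auto
qed

lemma lemon_curve_left:
  assumes "0 < b" "b < 2" and "s \<in> {2 * arccos (b / 2)<..<4 * arccos (b / 2)}"
  shows "lemon_curve b s \<in> sphere (of_real b) 1"
    and "(lemon_curve b has_vector_derivative lemon_tangent b (lemon_curve b s)) (at s)"
proof -
  define \<phi> where "\<phi> = arccos (b / 2)"
  note \<phi> = arccos_half_bounds[OF assms(1,2), folded \<phi>_def]
  have eq: "lemon_curve b t = of_real b - cis (t - 3 * \<phi>)" if "t \<in> {2 * \<phi><..<4 * \<phi>}" for t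
    using that by (simp add: lemon_curve_def \<phi>_def Let_def)
  have s: "s \<in> {2 * \<phi><..<4 * \<phi>}" using assms by (simp add: \<phi>_def)
  show "lemon_curve b s \<in> sphere (of_real b) 1" using eq[OF s] by (simp add: dist_norm)
  have "cos \<bar>s - 3 * \<phi>\<bar> > cos \<phi>"
    using s \<phi> by (intro cos_monotone_0_pi) auto
  then have c: "cos (s - 3 * \<phi>) > b / 2" using \<phi> by (simp add: cos_abs_real)
  have "(cmod (of_real b - cis (s - 3 * \<phi>)))\<^sup>2 =
      b\<^sup>2 - 2 * b * cos (s - 3 * \<phi>) + ((sin (s - 3 * \<phi>))\<^sup>2 + (cos (s - 3 * \<phi>))\<^sup>2)"
    unfolding cmod_power2 by (simp only: minus_complex.sel Re_complex_of_real Im_complex_of_real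
      cis.sel power2_eq_square) (simp only: algebra_simps)
  then have "(cmod (of_real b - cis (s - 3 * \<phi>)))\<^sup>2 = b\<^sup>2 - 2 * b * cos (s - 3 * \<phi>) + 1"
    by (simp only: sin_cos_squared_add)
  also have "\<dots> < 1"
    using c assms(1) by (simp add: power2_eq_square)
  finally have ns: "lemon_curve b s \<notin> sphere 0 1" using eq[OF s] by auto
  have "((\<lambda>t. of_real b - cis (t - 3 * \<phi>)) has_vector_derivative - (\<i> * cis (s - 3 * \<phi>))) (at s)"
    unfolding has_vector_derivative_complex_iff
    by (auto intro!: derivative_eq_intros)
  moreover have "lemon_tangent b (lemon_curve b s) = - (\<i> * cis (s - 3 * \<phi>))"
    using ns eq[OF s] by (simp add: lemon_tangent_def)
  ultimately show "(lemon_curve b has_vector_derivative lemon_tangent b (lemon_curve b s)) (at s)"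
    using has_vector_derivative_transform_within_open[of _ _ s "{2 * \<phi><..<4 * \<phi>}" "lemon_curve b"]
      eq s by auto
qed


lemma lemon_curve_bij:
  assumes "0 < b" "b < 2"
  shows "bij_betw (lemon_curve b) {0..<4 * arccos (b / 2)} (frontier (lemon_table b))"
proof -
  define \<phi> where "\<phi> = arccos (b / 2)"
  note \<phi> = arccos_half_bounds[OF assms, folded \<phi>_def]
  have pos: "cos t \<ge> b / 2 \<longleftrightarrow> \<bar>t\<bar> \<le> \<phi>" if "\<bar>t\<bar> \<le> pi" for t
    using cos_mono_le_eq[of \<phi> "\<bar>t\<bar>"] that \<phi> by (simp add: cos_abs_real)
  have pos': "cos t > b / 2 \<longleftrightarrow> \<bar>t\<bar> < \<phi>" if "\<bar>t\<bar> \<le> pi" for t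
    using cos_mono_less_eq[of \<phi> "\<bar>t\<bar>"] that \<phi> by (simp add: cos_abs_real)
  have curve: "lemon_curve b s = (if s < 2 * \<phi> then cis (s - \<phi>) else of_real b - cis (s - 3 * \<phi>))" for s
    by (simp add: lemon_curve_def \<phi>_def Let_def)
  have sq: "(cmod (p - of_real b))\<^sup>2 = (cmod p)\<^sup>2 - 2 * b * Re p + b\<^sup>2" for p
    unfolding cmod_power2 by (simp add: power2_eq_square algebra_simps)
  have le1: "cmod z \<le> 1 \<longleftrightarrow> (cmod z)\<^sup>2 \<le> 1" for z
    using abs_square_le_1[of "cmod z"] by simp
  have eq1: "cmod z = 1 \<longleftrightarrow> (cmod z)\<^sup>2 = 1" for z
    using abs_square_eq_1[of "cmod z"] by simp
  have F: "frontier (lemon_table b) = {p. cmod p = 1 \<and> Re p \<ge> b / 2} \<union>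
      {p. cmod (p - of_real b) = 1 \<and> Re p \<le> b / 2}" (is "_ = ?R \<union> ?L")
  proof -
    have "p \<in> frontier (lemon_table b) \<longleftrightarrow> p \<in> ?R \<union> ?L" for p
    proof -
      have a: "b * b \<le> 2 * b * x \<longleftrightarrow> b \<le> 2 * x" for x
        using mult_le_cancel_left_pos[of b b "2 * x"] assms by (simp add: ac_simps)
      have a': "b * b \<ge> 2 * b * x \<longleftrightarrow> b \<ge> 2 * x" for x
        using mult_le_cancel_left_pos[of b "2 * x" b] assms by (simp add: ac_simps)
      show ?thesis
        unfolding frontier_lemon_table[OF assms] using a[of "Re p"] a'[of "Re p"] sq[of p]
        unfolding le1 eq1 mem_Collect_eq Un_iff power2_eq_square[of b] by linarith
    qed
    then show ?thesis by blast
  qed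
  have arg: "\<exists>t. \<bar>t\<bar> \<le> pi \<and> z = cis t" if "cmod z = 1" for z
  proof -
    have "z \<noteq> 0" using that by (metis norm_zero zero_neq_one)
    then have "cis (Arg z) = z" using cis_Arg[of z] that by (simp add: sgn_eq)
    then show ?thesis using Arg_bounded[of z] by (intro exI[of _ "Arg z"]) (simp add: abs_le_iff)
  qed
  have inj: "x = y" if "cis x = cis y" "\<bar>x\<bar> \<le> \<phi>" "\<bar>y\<bar> \<le> \<phi>" for x y
  proof -
    have "Arg (cis x) = x" "Arg (cis y) = y"
      using that(2,3) \<phi> by (intro cis_Arg_unique; simp add: sgn_eq)+
    then show ?thesis using that(1) by metis
  qed
  show ?thesis
    unfolding \<phi>_def[symmetric]
  proof (rule bij_betw_imageI)
    have R: "Re (lemon_curve b s) > b / 2 \<or> s = 0" if "s \<in> {0..<2 * \<phi>}" for s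
      using that \<phi> pos'[of "s - \<phi>"] by (auto simp: curve)
    have L: "Re (lemon_curve b s) < b / 2 \<or> s = 2 * \<phi>" if "s \<in> {2 * \<phi>..<4 * \<phi>}" for s
      using that \<phi> pos'[of "s - 3 * \<phi>"] by (auto simp: curve)
    have I0: "Im (lemon_curve b 0) < 0" "Im (lemon_curve b (2 * \<phi>)) > 0"
      and R0: "Re (lemon_curve b 0) = b / 2" "Re (lemon_curve b (2 * \<phi>)) = b / 2"
      using \<phi> sin_gt_zero[of \<phi>] by (auto simp: curve)
    have ne: "lemon_curve b s \<noteq> lemon_curve b t"
      if "s \<in> {0..<2 * \<phi>}" "t \<in> {2 * \<phi>..<4 * \<phi>}" for s t
      using R[OF that(1)] L[OF that(2)] I0 R0 by fastforce
    show "inj_on (lemon_curve b) {0..<4 * \<phi>}"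
    proof (rule inj_onI)
      fix x y assume A: "x \<in> {0..<4 * \<phi>}" "y \<in> {0..<4 * \<phi>}" "lemon_curve b x = lemon_curve b y"
      consider "x < 2 * \<phi>" "y < 2 * \<phi>" | "x \<ge> 2 * \<phi>" "y \<ge> 2 * \<phi>"
        | "x < 2 * \<phi>" "y \<ge> 2 * \<phi>" | "x \<ge> 2 * \<phi>" "y < 2 * \<phi>" by linarith
      then show "x = y"
      proof cases
        case 1
        then show ?thesis using A inj[of "x - \<phi>" "y - \<phi>"] by (auto simp: curve)
      next
        case 2
        then show ?thesis using A inj[of "x - 3 * \<phi>" "y - 3 * \<phi>"] by (auto simp: curve)
      next
        case 3
        then show ?thesis using A ne[of x y] by auto
      next
        case 4
        then show ?thesis using A ne[of y x] by auto
      qed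
    qed
    show "lemon_curve b ` {0..<4 * \<phi>} = frontier (lemon_table b)"
    proof (intro equalityI subsetI)
      fix p assume "p \<in> lemon_curve b ` {0..<4 * \<phi>}"
      then obtain s where s: "p = lemon_curve b s" "0 \<le> s" "s < 4 * \<phi>" by auto
      show "p \<in> frontier (lemon_table b)"
        using s \<phi> pos[of "s - \<phi>"] pos[of "s - 3 * \<phi>"] unfolding F
        by (cases "s < 2 * \<phi>") (auto simp: curve)
    next
      fix p assume "p \<in> frontier (lemon_table b)"
      then consider "p \<in> ?R" | "p \<in> ?L" unfolding F by blast
      then show "p \<in> lemon_curve b ` {0..<4 * \<phi>}"
      proof cases
        case 1
        then obtain t where t: "\<bar>t\<bar> \<le> pi" "p = cis t" using arg by blast
        then have "\<bar>t\<bar> \<le> \<phi>" using 1 pos[of t] by auto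
        show ?thesis
        proof (cases "t = \<phi>")
          case True
          then have "p = lemon_curve b (2 * \<phi>)" using t \<phi> by (auto simp: curve complex_eq_iff)
          then show ?thesis using \<phi> by auto
        next
          case False
          then have "p = lemon_curve b (t + \<phi>)" using t \<open>\<bar>t\<bar> \<le> \<phi>\<close> by (auto simp: curve)
          then show ?thesis using \<phi> \<open>\<bar>t\<bar> \<le> \<phi>\<close> False by (auto intro!: imageI)
        qed
      next
        case 2
        then have "cmod (of_real b - p) = 1" by (simp add: norm_minus_commute)
        then obtain t where t: "\<bar>t\<bar> \<le> pi" "of_real b - p = cis t" using arg by blast
        have p: "p = of_real b - cis t" using t(2) by (simp add: algebra_simps flip: t(2))
        then have "\<bar>t\<bar> \<le> \<phi>" using 2 t pos[of t] by auto
        show ?thesis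
        proof (cases "t = \<phi>")
          case True
          then have "p = lemon_curve b 0" using p \<phi> by (auto simp: curve complex_eq_iff)
          then show ?thesis using \<phi> by auto
        next
          case False
          then have "p = lemon_curve b (t + 3 * \<phi>)" using p \<open>\<bar>t\<bar> \<le> \<phi>\<close> by (auto simp: curve)
          then show ?thesis using \<phi> \<open>\<bar>t\<bar> \<le> \<phi>\<close> False by (auto intro!: imageI)
        qed
      qed
    qed
  qed
qed

lemma norm_add_ray:
  "(cmod (a + of_real t * v))\<^sup>2 = (cmod a)\<^sup>2 + 2 * t * (v \<bullet> a) + t\<^sup>2 * (cmod v)\<^sup>2"
  unfolding cmod_power2 inner_complex_def by (simp add: power2_eq_square algebra_simps)

text \<open>At a point other than a corner, a velocity pointing into the table leads to exactly one
  further boundary point.\<close>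

lemma ray_exit_unique:
  assumes "0 < b" "b < 2" "p \<in> frontier (lemon_table b)" "p \<notin> lemon_corners b" "0 < \<theta>" "\<theta> < pi"
  shows "\<exists>!t. 0 < t \<and> p + of_real t * (cis \<theta> * lemon_tangent b p) \<in> frontier (lemon_table b)"
proof -
  define v where "v = cis \<theta> * lemon_tangent b p"
  have "\<exists>c d. {c, d} = {0, of_real b} \<and> cmod (p - c) = 1 \<and> cmod (p - d) < 1 \<and>
      lemon_tangent b p = \<i> * (p - c)"
  proof (cases "cmod p = 1")
    case True
    then show ?thesis using assms
      by (intro exI[of _ 0] exI[of _ "of_real b"])
        (auto simp: frontier_lemon_table lemon_corners_def lemon_tangent_def dist_norm norm_minus_commute)
  next
    case False
    then show ?thesis using assms
      by (intro exI[of _ "of_real b"] exI[of _ 0])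
        (auto simp: frontier_lemon_table lemon_corners_def lemon_tangent_def dist_norm norm_minus_commute)
  qed
  then obtain c d where cd: "{c, d} = {0, of_real b}" "cmod (p - c) = 1" "cmod (p - d) < 1"
    "lemon_tangent b p = \<i> * (p - c)" by blast
  have v1: "cmod v = 1" using cd by (simp add: v_def norm_mult)
  define \<alpha> where "\<alpha> = v \<bullet> (p - c)"
  define \<beta> where "\<beta> = v \<bullet> (p - d)"
  define \<rho> where "\<rho> = 1 - (cmod (p - d))\<^sup>2"
  have "\<alpha> = - sin \<theta> * (cmod (p - c))\<^sup>2"
    unfolding \<alpha>_def v_def cd(4) inner_complex_def cmod_power2 by (simp add: power2_eq_square algebra_simps)
  then have \<alpha>: "\<alpha> < 0" using assms sin_gt_zero[of \<theta>] by (simp add: cd)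
  have \<rho>: "\<rho> > 0" using cd(3) abs_square_less_1[of "cmod (p - d)"] by (simp add: \<rho>_def)
  have quad: "(cmod (p + of_real t * v - e))\<^sup>2 = (cmod (p - e))\<^sup>2 + 2 * t * (v \<bullet> (p - e)) + t\<^sup>2" for t e
  proof -
    have "p + of_real t * v - e = (p - e) + of_real t * v" by simp
    then show ?thesis by (simp only: norm_add_ray v1 power_one mult_1_right)
  qed
  define t1 where "t1 = - 2 * \<alpha>"
  define t2 where "t2 = sqrt (\<beta>\<^sup>2 + \<rho>) - \<beta>"
  define t3 where "t3 = - sqrt (\<beta>\<^sup>2 + \<rho>) - \<beta>"
  have "sqrt (\<beta>\<^sup>2 + \<rho>) > sqrt (\<beta>\<^sup>2)" using \<rho> by (intro real_sqrt_less_mono) auto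
  then have t: "t1 > 0" "t2 > 0" "t3 < 0" using \<alpha> by (auto simp: t1_def t2_def t3_def)
  have e1: "(cmod (p + of_real t * v - c))\<^sup>2 - 1 = t * (t - t1)" for t
    using quad[of t c] cd(2) by (simp add: \<alpha>_def t1_def power2_eq_square algebra_simps)
  have sqrt_sq: "(sqrt (\<beta>\<^sup>2 + \<rho>))\<^sup>2 = \<beta>\<^sup>2 + \<rho>" using \<rho> by simp
  have e2: "(cmod (p + of_real t * v - d))\<^sup>2 - 1 = (t - t2) * (t - t3)" for t
  proof -
    have "(t - t2) * (t - t3) = t\<^sup>2 + 2 * t * \<beta> + \<beta>\<^sup>2 - (sqrt (\<beta>\<^sup>2 + \<rho>))\<^sup>2"
      by (simp add: t2_def t3_def power2_eq_square algebra_simps)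
    also have "\<dots> = t\<^sup>2 + 2 * t * \<beta> - \<rho>" using sqrt_sq by simp
    also have "\<dots> = (cmod (p + of_real t * v - d))\<^sup>2 - 1"
      using quad[of t d] by (simp only: \<beta>_def \<rho>_def)
    finally show ?thesis by simp
  qed
  have le1: "cmod z \<le> 1 \<longleftrightarrow> (cmod z)\<^sup>2 - 1 \<le> 0" and eq1: "cmod z = 1 \<longleftrightarrow> (cmod z)\<^sup>2 - 1 = 0" for z
    using abs_square_le_1[of "cmod z"] abs_square_eq_1[of "cmod z"] by simp_all
  have fr: "q \<in> frontier (lemon_table b) \<longleftrightarrow>
      cmod (q - c) \<le> 1 \<and> cmod (q - d) \<le> 1 \<and> (cmod (q - c) = 1 \<or> cmod (q - d) = 1)" for q
    using cd(1) unfolding frontier_lemon_table[OF assms(1,2)] by (auto simp: doubleton_eq_iff)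
  have "p + of_real t * v \<in> frontier (lemon_table b) \<longleftrightarrow> t = min t1 t2" if "t > 0" for t
  proof -
    have "t * (t - t1) \<le> 0 \<longleftrightarrow> t \<le> t1" "t * (t - t1) = 0 \<longleftrightarrow> t = t1"
      using mult_le_0_iff[of t "t - t1"] that by auto
    moreover have "(t - t2) * (t - t3) \<le> 0 \<longleftrightarrow> t \<le> t2" "(t - t2) * (t - t3) = 0 \<longleftrightarrow> t = t2"
      using mult_le_0_iff[of "t - t2" "t - t3"] that t(3) by auto
    ultimately show ?thesis
      unfolding fr le1 eq1 e1 e2 min_def by auto
  qed
  then show ?thesis
    unfolding v_def[symmetric] by (intro ex1I[of _ "min t1 t2"]) (use t in auto)
qed

lemma lemon_map_in_phase:
  assumes "0 < b" "b < 2" "x \<in> lemon_phase b"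
    "fst x \<notin> lemon_corners b" "fst (lemon_map b x) \<notin> lemon_corners b"
  shows "lemon_map b x \<in> lemon_phase b"
proof -
  obtain p \<theta> where x: "x = (p, \<theta>)" by force
  show ?thesis
  proof (cases "\<theta> = 0 \<or> \<theta> = pi")
    case True
    then show ?thesis using assms by (simp add: x lemon_map_def)
  next
    case False
    then have p: "p \<in> frontier (lemon_table b)" "p \<notin> lemon_corners b" "0 < \<theta>" "\<theta> < pi"
      using assms by (auto simp: x lemon_phase_def)
    define v where "v = cis \<theta> * lemon_tangent b p"
    define q where "q = next_hit b p v"
    define \<tau> where "\<tau> = lemon_tangent b q"
    have map: "lemon_map b x = (q, Arg (reflect_in \<tau> v / \<tau>))"
      using False by (simp add: x lemon_map_def v_def q_def \<tau>_def Let_def)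
    obtain t where t: "0 < t \<and> p + of_real t * v \<in> frontier (lemon_table b)"
      "\<forall>t'. 0 < t' \<and> p + of_real t' * v \<in> frontier (lemon_table b) \<longrightarrow> t' = t"
      using ray_exit_unique[OF assms(1,2) p] unfolding v_def[symmetric] by (rule ex1E)
    have "(LEAST t. 0 < t \<and> p + of_real t * v \<in> frontier (lemon_table b)) = t"
      by (rule Least_equality) (fact t(1), use t(2) in \<open>metis order_refl\<close>)
    then have q: "q = p + of_real t * v" by (simp add: q_def next_hit_def)
    have qf: "q \<in> frontier (lemon_table b)" using t(1) q by simp
    obtain c where c: "cmod (q - c) = 1" "\<tau> = \<i> * (q - c)" "cmod (p - c) \<le> 1"
    proof (cases "cmod q = 1")
      case True
      then show ?thesis using that[of 0] p qf assms
        by (auto simp: \<tau>_def lemon_tangent_def frontier_lemon_table)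
    next
      case False
      then show ?thesis using that[of "of_real b"] p qf assms
        by (auto simp: \<tau>_def lemon_tangent_def frontier_lemon_table)
    qed
    have \<tau>1: "cmod \<tau> = 1" using c by (simp add: norm_mult)
    have "p - c = (q - c) + of_real (- t) * v" by (simp add: q)
    then have "(cmod (p - c))\<^sup>2 = (cmod (q - c))\<^sup>2 - 2 * t * (v \<bullet> (q - c)) + t\<^sup>2 * (cmod v)\<^sup>2"
      by (simp only: norm_add_ray) simp
    moreover have "(cmod (p - c))\<^sup>2 \<le> 1" using c(3) by (simp add: power_le_one)
    moreover have "(cmod (q - c))\<^sup>2 = 1" by (simp only: c(1) power_one)
    moreover have "t\<^sup>2 * (cmod v)\<^sup>2 \<ge> 0" by simp
    ultimately have "2 * t * (v \<bullet> (q - c)) \<ge> 0" by linarith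
    then have "v \<bullet> (q - c) \<ge> 0" using t(1)[THEN conjunct1] zero_le_mult_iff[of "2 * t" "v \<bullet> (q - c)"] by linarith
    moreover have "reflect_in \<tau> v / \<tau> = \<tau> * cnj v"
    proof -
      have "\<tau> \<noteq> 0" using \<tau>1 by (metis norm_zero zero_neq_one)
      then show ?thesis unfolding reflect_in_def power2_eq_square by simp
    qed
    moreover have "Im (\<tau> * cnj v) = v \<bullet> (q - c)"
      unfolding c(2) inner_complex_def by (simp add: algebra_simps)
    ultimately have "Im (reflect_in \<tau> v / \<tau>) \<ge> 0" by simp
    then have "0 \<le> Arg (reflect_in \<tau> v / \<tau>)" by (metis Arg_less_0 not_le)
    then show ?thesis using qf Arg_bounded[of "reflect_in \<tau> v / \<tau>"]
      by (simp add: map lemon_phase_def)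
  qed
qed

lemma lemon_domain_invariant:
  assumes "0 < b" "b < 2" "x \<in> lemon_domain b"
  shows "lemon_map b x \<in> lemon_domain b"
proof -
  have nc: "fst ((lemon_map b ^^ n) x) \<notin> lemon_corners b" for n
    using assms(3) by (simp add: lemon_domain_def)
  have "fst ((lemon_map b ^^ n) (lemon_map b x)) \<notin> lemon_corners b" for n
    using nc[of "Suc n"] unfolding funpow_Suc_right o_apply .
  moreover have "lemon_map b x \<in> lemon_phase b"
    using lemon_map_in_phase[OF assms(1,2)] nc[of 0] nc[of 1] assms(3)
    by (simp add: lemon_domain_def)
  ultimately show ?thesis by (simp add: lemon_domain_def)
qed

end

theory Submission
  imports Defs
begin

text \<open>
  For every \<open>b\<close> slightly above \<open>3/2\<close> some orbits of the billiard map code a full shift on two symbols, so its entropy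
  is positive and the set in question is empty.  The orbits used bounce \<open>n \<in> {4, 5}\<close> times along one
  arc at a constant angle \<open>\<theta>\<close>, cross to the other arc near a corner, return at once, and slide back
  along the first arc in the opposite direction.  Let \<open>y\<close> and \<open>x\<close> be the polar angles, about the centre
  of the sliding arc, of the midpoints of the full chords through which the orbit enters and leaves the
  slide (\<open>y\<close> measured clockwise and \<open>x\<close> counterclockwise).  Then \<open>x + y = 2 n \<theta>\<close>, and the crossing
  from one slide to the next (primed) is described by
  \<open>cos \<theta> = b cos x + sin ((x - y') / 2)\<close> and \<open>cos \<theta>' = b cos y' + sin ((y' - x) / 2)\<close>.

  For each sequence of values \<open>n\<close> these equations have a solution.  They are the fixed point equations
  of a map which is monotone after reversing the order of the unknowns of every second slide and which
  preserves a box, so the argument of Knaster and Tarski applies; no contraction estimate is needed.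
  The angle \<open>\<theta>\<close> tells \<open>n = 4\<close> from \<open>n = 5\<close>, which separates the orbits of different codes.
\<close>

section \<open>Trigonometric bounds and a fixed point lemma\<close>

text \<open>Reversing the order in the coordinates with \<open>\<sigma> i = -1\<close> makes the box
  a complete lattice and \<open>T\<close> monotone on it. The supremum \<open>s\<close> of the set
  \<open>D\<close> of points that \<open>T\<close> does not decrease is then fixed: \<open>s\<close>
  is in \<open>D\<close>, hence so is \<open>T s\<close>, and \<open>T s\<close> cannot exceed
  \<open>s\<close>.\<close>

lemma signed_monotone_fixpoint:
  fixes T :: "('i \<Rightarrow> real) \<Rightarrow> 'i \<Rightarrow> real" and lo hi \<sigma> :: "'i \<Rightarrow> real"
  assumes sgn: "\<And>i. \<sigma> i = 1 \<or> \<sigma> i = -1"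
    and ne: "\<And>i. lo i \<le> hi i"
    and box: "\<And>u i. (\<And>j. lo j \<le> u j \<and> u j \<le> hi j) \<Longrightarrow> lo i \<le> T u i \<and> T u i \<le> hi i"
    and mono: "\<And>u v i. (\<And>j. lo j \<le> u j \<and> u j \<le> hi j) \<Longrightarrow> (\<And>j. lo j \<le> v j \<and> v j \<le> hi j) \<Longrightarrow>
      (\<And>j. \<sigma> j * u j \<le> \<sigma> j * v j) \<Longrightarrow> \<sigma> i * T u i \<le> \<sigma> i * T v i"
  shows "\<exists>u. (\<forall>i. lo i \<le> u i \<and> u i \<le> hi i) \<and> T u = u"
proof -
  define B where "B = {u. \<forall>i. lo i \<le> u i \<and> u i \<le> hi i}"
  define D where "D = {u \<in> B. \<forall>i. \<sigma> i * u i \<le> \<sigma> i * T u i}"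
  define S where "S i = Sup ((\<lambda>u. \<sigma> i * u i) ` D)" for i
  define s where "s i = \<sigma> i * S i" for i
  have \<sigma>\<sigma>: "\<sigma> i * (\<sigma> i * r) = r" for i r
    using sgn[of i] by auto
  have \<sigma>s: "\<sigma> i * s i = S i" for i
    by (simp add: s_def \<sigma>\<sigma>)
  \<comment> \<open>This is the bottom of the box in the signed order, so \<open>T\<close> cannot
    decrease it.\<close>
  have "(\<lambda>i. if \<sigma> i = 1 then lo i else hi i) \<in> D" (is "?bot \<in> D")
  proof -
    have "?bot \<in> B" using ne by (auto simp: B_def)
    moreover have "\<sigma> i * ?bot i \<le> \<sigma> i * T ?bot i" for i
    proof -
      have "lo i \<le> T ?bot i \<and> T ?bot i \<le> hi i"
        by (intro box) (use ne in auto)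
      then show ?thesis using sgn[of i] by (auto simp: eq_neg_iff_add_eq_0)
    qed
    ultimately show ?thesis by (simp add: D_def)
  qed
  then have Dne: "D \<noteq> {}" by auto
  have bnd: "\<sigma> i * u i \<le> max (hi i) (- lo i)" if "u \<in> B" for u i
  proof -
    have "lo i \<le> u i" "u i \<le> hi i" using that by (auto simp: B_def)
    then show ?thesis using sgn[of i] by (auto simp: le_max_iff_disj)
  qed
  have bdd: "bdd_above ((\<lambda>u. \<sigma> i * u i) ` D)" for i
    by (intro bdd_aboveI2[of _ _ "max (hi i) (- lo i)"] bnd) (auto simp: D_def)
  have up: "\<sigma> i * u i \<le> S i" if "u \<in> D" for u i
    unfolding S_def using bdd that by (intro cSUP_upper) auto
  have least: "S i \<le> r" if "\<And>u. u \<in> D \<Longrightarrow> \<sigma> i * u i \<le> r" for i r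
    unfolding S_def using Dne that by (intro cSUP_least) auto
  have sB: "s \<in> B"
  proof -
    obtain u where u: "u \<in> D" using Dne by auto
    have box_D: "lo i \<le> v i" "v i \<le> hi i" if "v \<in> D" for v i
      using that by (auto simp: D_def B_def)
    have "lo i \<le> s i \<and> s i \<le> hi i" for i
    proof (cases "\<sigma> i = 1")
      case True
      then have "S i \<le> hi i" by (intro least) (simp add: box_D)
      then show ?thesis using True up[OF u, of i] box_D[OF u, of i] by (simp add: s_def)
    next
      case False
      then have \<sigma>: "\<sigma> i = -1" using sgn by blast
      then have "S i \<le> - lo i" by (intro least) (simp add: box_D)
      then show ?thesis using \<sigma> up[OF u, of i] box_D[OF u, of i] by (simp add: s_def)
    qed
    then show ?thesis by (auto simp: B_def)
  qed
  have m: "\<sigma> i * T u i \<le> \<sigma> i * T v i" if "u \<in> B" "v \<in> B" "\<And>j. \<sigma> j * u j \<le> \<sigma> j * v j" for u v i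
    using that by (intro mono) (auto simp: B_def)
  have post: "S i \<le> \<sigma> i * T s i" for i
  proof (rule least)
    fix u assume u: "u \<in> D"
    then have "\<sigma> i * u i \<le> \<sigma> i * T u i" by (simp add: D_def)
    also have "\<dots> \<le> \<sigma> i * T s i"
      using u sB up[OF u] by (intro m) (auto simp: D_def \<sigma>s)
    finally show "\<sigma> i * u i \<le> \<sigma> i * T s i" .
  qed
  have TB: "T s \<in> B" using sB box[of s] by (auto simp: B_def)
  have "T s \<in> D"
    unfolding D_def using TB m[OF sB TB] post \<sigma>s by auto
  then have "\<sigma> i * T s i \<le> S i" for i by (rule up)
  then have "\<sigma> i * T s i = \<sigma> i * s i" for i using post[of i] \<sigma>s[of i] by (metis order_antisym)
  then have "T s = s" using \<sigma>\<sigma> by (metis ext)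
  then show ?thesis using sB by (auto simp: B_def)
qed

section \<open>Taylor bounds for cosine and sine\<close>

lemma cos_taylor_6:
  fixes x :: real
  shows "\<bar>cos x - (1 - x^2/2 + x^4/24 - x^6/720)\<bar> \<le> x^8/40320"
proof -
  obtain t where t: "cos x = (\<Sum>m<8. cos_coeff m * x ^ m) +
      (cos (t + 1/2 * real (8::nat) * pi) / fact 8) * x ^ 8"
    using Maclaurin_cos_expansion[of x 8] by blast
  have "(\<Sum>m<8. cos_coeff m * x ^ m) = 1 - x^2/2 + x^4/24 - x^6/720"
    by (simp add: cos_coeff_def lessThan_nat_numeral fact_numeral)
  then have "cos x - (1 - x^2/2 + x^4/24 - x^6/720) =
      cos (t + 1/2 * real (8::nat) * pi) * (x^8 / 40320)"
    using t by (simp add: fact_numeral)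
  then have "\<bar>cos x - (1 - x^2/2 + x^4/24 - x^6/720)\<bar> =
      \<bar>cos (t + 1/2 * real (8::nat) * pi)\<bar> * (x^8 / 40320)"
    by (simp only: abs_mult) simp
  also have "\<dots> \<le> 1 * (x^8 / 40320)"
    by (intro mult_right_mono abs_cos_le_one) simp
  finally show ?thesis by simp
qed

lemma cos_lower_8:
  fixes z :: real
  shows "1 - z^2/2 + z^4/24 - z^6/720 - z^8/40320 \<le> cos z"
  using cos_taylor_6[of z] unfolding abs_le_iff by linarith

lemma cos_upper_8:
  fixes z :: real
  shows "cos z \<le> 1 - z^2/2 + z^4/24 - z^6/720 + z^8/40320"
  using cos_taylor_6[of z] unfolding abs_le_iff by linarith

lemma sin_taylor_3:
  fixes x :: real
  assumes "0 \<le> x"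
  shows "x - x^3/6 \<le> sin x"
proof -
  have "\<bar>sin x - (\<Sum>m<3. sin_coeff m * x ^ m)\<bar> \<le> inverse (fact 3) * \<bar>x\<bar> ^ 3"
    by (rule Maclaurin_sin_bound)
  moreover have "(\<Sum>m<3. sin_coeff m * x ^ m) = x"
    by (simp add: sin_coeff_def lessThan_nat_numeral)
  ultimately show ?thesis
    using assms unfolding abs_le_iff by (simp add: fact_numeral)
qed


section \<open>Bounces off the arcs\<close>

text \<open>A relational form of one billiard step, free of \<open>LEAST\<close> and
  \<open>Arg\<close>, so that it can be checked by complex algebra. The last conjunct is the
  reflection law: rotating the incoming velocity by the outgoing angle gives the tangent.\<close>

definition bounce :: "real \<Rightarrow> complex \<times> real \<Rightarrow> complex \<times> real \<Rightarrow> bool" where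
  "bounce b P Q \<longleftrightarrow> P \<in> lemon_phase b \<and> fst P \<notin> lemon_corners b \<and>
     0 < snd P \<and> snd P < pi \<and> 0 < snd Q \<and> snd Q < pi \<and> fst Q \<in> frontier (lemon_table b) \<and>
     (\<exists>t>0. fst Q - fst P = of_real t * (cis (snd P) * lemon_tangent b (fst P))) \<and>
     cis (snd Q) * (cis (snd P) * lemon_tangent b (fst P)) = lemon_tangent b (fst Q)"

lemma norm_lemon_tangent:
  assumes "0 < b" "b < 2" "p \<in> frontier (lemon_table b)"
  shows "cmod (lemon_tangent b p) = 1"
  using assms by (auto simp: frontier_lemon_table lemon_tangent_def norm_mult)

text \<open>By \<open>ray_exit_unique\<close>, any boundary point found ahead on the ray is the next
  hit. The reflected direction relative to the unit tangent \<open>\<tau>\<close> is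
  \<open>\<tau> * cnj v\<close>, which the reflection law turns into
  \<open>cis \<theta>'\<close>.\<close>

lemma bounce_imp_lemon_map:
  assumes b: "0 < b" "b < 2" and "bounce b P Q"
  shows "lemon_map b P = Q"
proof -
  obtain p \<theta> where P: "P = (p, \<theta>)" by force
  obtain q \<theta>' where Q: "Q = (q, \<theta>')" by force
  define v where "v = cis \<theta> * lemon_tangent b p"
  obtain t where p: "p \<in> frontier (lemon_table b)" "p \<notin> lemon_corners b" "0 < \<theta>" "\<theta> < pi"
    and q: "q \<in> frontier (lemon_table b)" "0 < \<theta>'" "\<theta>' < pi"
    and t: "0 < t" "q - p = of_real t * v" and \<theta>': "cis \<theta>' * v = lemon_tangent b q"
    using assms(3) by (auto simp: bounce_def P Q v_def lemon_phase_def)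
  have qv: "q = p + of_real t * v"
    using t(2) by (metis add.commute diff_add_cancel)
  have "(LEAST s. 0 < s \<and> p + of_real s * v \<in> frontier (lemon_table b)) = t"
  proof (rule Least_equality)
    show "0 < t \<and> p + of_real t * v \<in> frontier (lemon_table b)"
      using t q qv by simp
  next
    fix s assume "0 < s \<and> p + of_real s * v \<in> frontier (lemon_table b)"
    then have "s = t"
      using ray_exit_unique[OF b p] t(1) q(1) unfolding v_def[symmetric] qv by blast
    then show "t \<le> s" by simp
  qed
  then have hit: "next_hit b p v = q"
    by (simp add: next_hit_def qv)
  have "cmod v = 1" by (simp add: v_def norm_mult norm_lemon_tangent b p)
  then have "v * cnj v = 1" by (simp add: complex_norm_square[symmetric])
  moreover from this have "v \<noteq> 0" by auto
  ultimately have "reflect_in (lemon_tangent b q) v / lemon_tangent b q = cis \<theta>'"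
    using norm_lemon_tangent[OF b q(1)]
    by (simp add: reflect_in_def power2_eq_square \<theta>'[symmetric] mult.assoc)
  moreover have "Arg (cis \<theta>') = \<theta>'"
    using q by (intro cis_Arg_unique) auto
  ultimately show ?thesis
    using p by (simp add: P Q lemon_map_def v_def[symmetric] hit Let_def)
qed

text \<open>The symmetry of the table in the axis through the centres reverses orientation, whence
  \<open>pi - \<theta>\<close>.\<close>

definition mirror :: "complex \<times> real \<Rightarrow> complex \<times> real" where
  "mirror P = (cnj (fst P), pi - snd P)"

lemma mirror_mirror [simp]: "mirror (mirror P) = P"
  by (simp add: mirror_def)

lemma cnj_mem_frontier:
  assumes "0 < b" "b < 2"
  shows "cnj p \<in> frontier (lemon_table b) \<longleftrightarrow> p \<in> frontier (lemon_table b)"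
proof -
  have "cmod (cnj p - of_real b) = cmod (p - of_real b)"
    by (metis complex_cnj_complex_of_real complex_cnj_diff complex_mod_cnj)
  then show ?thesis using assms by (simp add: frontier_lemon_table)
qed

lemma cnj_mem_corners: "cnj p \<in> lemon_corners b \<longleftrightarrow> p \<in> lemon_corners b"
proof -
  have "cmod (of_real b - cnj p) = cmod (of_real b - p)"
    by (metis complex_cnj_complex_of_real complex_cnj_diff complex_mod_cnj)
  then show ?thesis by (simp add: lemon_corners_def dist_norm)
qed

lemma lemon_tangent_cnj: "lemon_tangent b (cnj p) = - cnj (lemon_tangent b p)"
  by (simp add: lemon_tangent_def)

lemma cis_pi_minus: "cis (pi - \<theta>) = - cnj (cis \<theta>)"
  by (simp add: complex_eq_iff)

text \<open>Under conjugation each tangent and each \<open>cis\<close> of an angle picks up a sign,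
  and the signs balance in both equations.\<close>

lemma bounce_mirror:
  assumes b: "0 < b" "b < 2" and "bounce b P Q"
  shows "bounce b (mirror P) (mirror Q)"
proof -
  obtain t where t: "0 < t" "fst Q - fst P = of_real t * (cis (snd P) * lemon_tangent b (fst P))"
    and q: "cis (snd Q) * (cis (snd P) * lemon_tangent b (fst P)) = lemon_tangent b (fst Q)"
    using assms(3) by (auto simp: bounce_def)
  have "cnj (fst Q) - cnj (fst P) = of_real t * (cis (pi - snd P) * lemon_tangent b (cnj (fst P)))"
    using arg_cong[OF t(2), of cnj] by (simp add: lemon_tangent_cnj cis_pi_minus)
  moreover have "cis (pi - snd Q) * (cis (pi - snd P) * lemon_tangent b (cnj (fst P))) =
      lemon_tangent b (cnj (fst Q))"
    using arg_cong[OF q, of cnj] by (simp add: lemon_tangent_cnj cis_pi_minus)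
  ultimately show ?thesis
    using assms(3) t(1) by (auto simp: bounce_def mirror_def lemon_phase_def cnj_mem_frontier[OF b] cnj_mem_corners)
qed

section \<open>Points of the two arcs and chords of a single arc\<close>

lemma sq_dist_cis: "(cmod (cis \<psi> - of_real b))\<^sup>2 = 1 + b\<^sup>2 - 2 * b * cos \<psi>"
proof -
  have "(cmod (cis \<psi> - of_real b))\<^sup>2 = (cos \<psi>)\<^sup>2 + (sin \<psi>)\<^sup>2 + b\<^sup>2 - 2 * b * cos \<psi>"
    unfolding cmod_power2 by (simp add: power2_eq_square algebra_simps)
  then show ?thesis by simp
qed

text \<open>The line \<open>Re = b / 2\<close> carries the common chord of the two circles; points
  of the unit circle to its right lie inside the other disk.\<close>

lemma dist_cis_less_1:
  assumes "0 < b" "b / 2 < cos \<psi>"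
  shows "cmod (cis \<psi> - of_real b) < 1"
proof -
  have "b * b < b * (2 * cos \<psi>)"
    using assms by (intro mult_strict_left_mono) auto
  then have "(cmod (cis \<psi> - of_real b))\<^sup>2 < 1"
    unfolding sq_dist_cis by (simp add: power2_eq_square)
  then show ?thesis by (simp add: abs_square_less_1)
qed

lemma right_arc_point:
  assumes b: "0 < b" "b < 2" and "b / 2 < cos \<psi>"
  shows "cis \<psi> \<in> frontier (lemon_table b)" "cis \<psi> \<notin> lemon_corners b"
    "lemon_tangent b (cis \<psi>) = \<i> * cis \<psi>"
proof -
  have "cmod (cis \<psi> - of_real b) < 1" by (rule dist_cis_less_1[OF b(1) assms(3)])
  then show "cis \<psi> \<in> frontier (lemon_table b)" "cis \<psi> \<notin> lemon_corners b"
    using b by (simp_all add: frontier_lemon_table lemon_corners_def dist_norm norm_minus_commute)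
  show "lemon_tangent b (cis \<psi>) = \<i> * cis \<psi>" by (simp add: lemon_tangent_def)
qed

lemma left_arc_point:
  assumes b: "0 < b" "b < 2" and "b / 2 < cos \<psi>"
  shows "of_real b - cis \<psi> \<in> frontier (lemon_table b)" "of_real b - cis \<psi> \<notin> lemon_corners b"
    "lemon_tangent b (of_real b - cis \<psi>) = - \<i> * cis \<psi>"
proof -
  have *: "cmod (of_real b - cis \<psi>) < 1"
    using dist_cis_less_1[OF b(1) assms(3)] by (simp add: norm_minus_commute)
  then show "of_real b - cis \<psi> \<in> frontier (lemon_table b)" "of_real b - cis \<psi> \<notin> lemon_corners b"
    using b by (simp_all add: frontier_lemon_table lemon_corners_def dist_norm norm_minus_commute)
  show "lemon_tangent b (of_real b - cis \<psi>) = - \<i> * cis \<psi>" using * by (simp add: lemon_tangent_def)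
qed

text \<open>A chord of the unit circle meeting it at angle \<theta> subtends the angle 2\<theta> at
  the centre and has length \<open>2 * sin \<theta>\<close>.\<close>

lemma bounce_slide:
  assumes b: "0 < b" "b < 2" and "0 < \<theta>" "\<theta> < pi"
    and "b / 2 < cos \<psi>" "b / 2 < cos (\<psi> + 2 * \<theta>)"
  shows "bounce b (cis \<psi>, \<theta>) (cis (\<psi> + 2 * \<theta>), \<theta>)"
proof -
  have "cis (\<psi> + 2 * \<theta>) = cis \<psi> * cis \<theta> * cis \<theta>"
    by (simp add: cis_mult add.assoc)
  moreover have "cis \<theta> * cis (- \<theta>) = 1" by (simp add: cis_mult)
  moreover have "cis \<theta> - cis (- \<theta>) = of_real (2 * sin \<theta>) * \<i>" by (simp add: complex_eq_iff)
  ultimately have chord: "cis (\<psi> + 2 * \<theta>) - cis \<psi> = of_real (2 * sin \<theta>) * (cis \<theta> * (\<i> * cis \<psi>))"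
    by algebra
  have "cis \<theta> * (cis \<theta> * (\<i> * cis \<psi>)) = \<i> * cis (\<psi> + 2 * \<theta>)"
    by (simp add: cis_mult add.commute add.left_commute)
  then show ?thesis
    unfolding bounce_def lemon_phase_def
    using assms chord sin_gt_zero[of \<theta>]
    by (simp add: right_arc_point) (rule exI[of _ "2 * sin \<theta>"], simp)
qed


section \<open>Crossing from one arc to the other\<close>

text \<open>In a frame rotated by \<open>x\<close>, the chord from the last bounce of a slide to the other arc has length
  \<open>cos t + sin \<theta> - b * sin x\<close>.  The other two conclusions say that its end points lie strictly
  inside the respective other disk.\<close>

lemma crossing_geometry:
  fixes b x t \<theta> :: real
  assumes "0 < b" "0 < sin x" "0 < cos t" "0 < sin \<theta>"
    and eq: "cos \<theta> = b * cos x + sin t"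
    and "b\<^sup>2 / 2 - 1 < sin (\<theta> - t)" "1 - b\<^sup>2 / 2 < sin (\<theta> + t)"
  shows "0 < cos t + sin \<theta> - b * sin x" "b / 2 < sin (x - t)" "b / 2 < cos (x - \<theta>)"
proof -
  define X where "X = b * sin x"
  note pyth = sin_cos_squared_add[of x] sin_cos_squared_add[of t] sin_cos_squared_add[of \<theta>]
  have X: "0 < X" using assms by (simp add: X_def)
  \<comment> \<open>The two hypotheses on sines amount to
    \<open>\<bar>cos t - sin \<theta>\<bar> < X < cos t + sin \<theta>\<close>. The quantities to be
    shown positive, times \<open>b\<close>, factor into these differences.\<close>
  have "(cos t + sin \<theta>)\<^sup>2 - X\<^sup>2 = 2 + 2 * sin (\<theta> - t) - b\<^sup>2"
    unfolding X_def sin_diff using pyth eq by algebra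
  then have "X\<^sup>2 < (cos t + sin \<theta>)\<^sup>2" using assms(6) by linarith
  then have 1: "X < cos t + sin \<theta>"
    by (rule power2_less_imp_less) (use assms in simp)
  have "X\<^sup>2 - (cos t - sin \<theta>)\<^sup>2 = b\<^sup>2 - 2 + 2 * sin (\<theta> + t)"
    unfolding X_def sin_add using pyth eq by algebra
  then have "(cos t - sin \<theta>)\<^sup>2 < X\<^sup>2" using assms(7) by linarith
  then have "\<bar>cos t - sin \<theta>\<bar> < \<bar>X\<bar>"
    using abs_le_square_iff[of X "cos t - sin \<theta>"] by linarith
  then have 2: "cos t - sin \<theta> < X" "sin \<theta> - cos t < X"
    using X by auto
  show "0 < cos t + sin \<theta> - b * sin x" using 1 by (simp add: X_def)
  have "b * (2 * sin (x - t) - b) = (sin \<theta> - cos t + X) * (cos t + sin \<theta> - X)"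
    unfolding X_def sin_diff using pyth eq by algebra
  also have "\<dots> > 0" using 1 2 by simp
  finally show "b / 2 < sin (x - t)" using \<open>0 < b\<close> by (simp add: zero_less_mult_iff)
  have "b * (2 * cos (x - \<theta>) - b) = (cos t + sin \<theta> - X) * (cos t - sin \<theta> + X)"
    unfolding X_def cos_diff using pyth eq by algebra
  also have "\<dots> > 0" by (intro mult_pos_pos) (use 1 2 in linarith)+
  finally show "b / 2 < cos (x - \<theta>)" using \<open>0 < b\<close> by (simp add: zero_less_mult_iff)
qed

text \<open>After rotation by \<open>-x\<close> the velocity is vertical. The real parts of the two
  end points then agree exactly by \<open>eq\<close>, and their imaginary parts differ by the chord
  length. The landing point is symmetric in \<open>x\<close> and \<open>y\<close>, so the return
  chord can start from it with the roles of \<open>x\<close> and \<open>y\<close> exchanged.\<close>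

lemma bounce_exit:
  fixes b x y \<theta> :: real
  defines "t \<equiv> (x - y) / 2"
  assumes b: "0 < b" "b < 2" and \<theta>: "0 < \<theta>" "\<theta> < pi" and t: "\<bar>t\<bar> < pi / 2" and "0 < sin x"
    and eq: "cos \<theta> = b * cos x + sin t"
    and "b\<^sup>2 / 2 - 1 < sin (\<theta> - t)" "1 - b\<^sup>2 / 2 < sin (\<theta> + t)"
  shows "b / 2 < cos (x - \<theta>)"
    and "bounce b (cis (x - \<theta>), \<theta>) (of_real b - cis ((x + y - pi) / 2), pi / 2 - t)"
proof -
  have "0 < cos t" "0 < sin \<theta>"
    using t \<theta> by (auto intro: cos_gt_zero_pi sin_gt_zero)
  note geo = crossing_geometry[OF b(1) \<open>0 < sin x\<close> this eq assms(9,10)]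
  show pos: "b / 2 < cos (x - \<theta>)" by (rule geo(3))
  have "cos ((x + y - pi) / 2) = sin (x - t)"
  proof -
    have *: "(x + y - pi) / 2 = (x - t) - pi / 2" by (simp add: t_def field_simps)
    show ?thesis unfolding * cos_diff[of _ "pi / 2"] by simp
  qed
  then have pos': "b / 2 < cos ((x + y - pi) / 2)" using geo(2) by simp
  define T where "T = cos t + sin \<theta> - b * sin x"
  have "(x + y - pi) / 2 = x + (- t - pi / 2)" by (simp add: t_def field_simps)
  then have 1: "cis ((x + y - pi) / 2) = cis x * cis (- t - pi / 2)"
    unfolding cis_mult by (rule arg_cong)
  have 2: "cis (x - \<theta>) = cis x * cis (- \<theta>)" by (simp add: cis_mult)
  have 3: "cis \<theta> * (\<i> * cis (x - \<theta>)) = cis x * \<i>" by (simp add: cis_mult mult.left_commute)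
  have 4: "cis x * cis (- x) = 1" by (simp add: cis_mult)
  have "of_real b * cis (- x) - cis (- t - pi / 2) - cis (- \<theta>) = of_real T * \<i>"
    using eq by (simp add: complex_eq_iff T_def cos_diff sin_diff)
  then have chord: "of_real b - cis ((x + y - pi) / 2) - cis (x - \<theta>) =
      of_real T * (cis \<theta> * (\<i> * cis (x - \<theta>)))"
    unfolding 1 2 3[unfolded 2] using 4 by algebra
  have "cis (pi / 2 - t) * (cis x * \<i>) = - \<i> * cis ((x + y - pi) / 2)"
    unfolding 1 by (simp add: complex_eq_iff cos_diff sin_diff)
  then show "bounce b (cis (x - \<theta>), \<theta>) (of_real b - cis ((x + y - pi) / 2), pi / 2 - t)"
    unfolding bounce_def lemon_phase_def
    using right_arc_point[OF b pos] left_arc_point[OF b pos'] chord geo(1) \<theta> t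
    by (simp add: 3 T_def[symmetric]) (auto simp: abs_less_iff)
qed

text \<open>This is the crossing chord for \<open>y\<close> in place of \<open>x\<close>, traversed
  backwards. The slide that follows runs clockwise, so its first state is written as the mirror
  image of a counterclockwise one.\<close>

lemma bounce_enter:
  fixes b x y \<theta> :: real
  defines "t \<equiv> (y - x) / 2"
  assumes b: "0 < b" "b < 2" and \<theta>: "0 < \<theta>" "\<theta> < pi" and t: "\<bar>t\<bar> < pi / 2" and "0 < sin y"
    and eq: "cos \<theta> = b * cos y + sin t"
    and "b\<^sup>2 / 2 - 1 < sin (\<theta> - t)" "1 - b\<^sup>2 / 2 < sin (\<theta> + t)"
  shows "b / 2 < cos (y - \<theta>)"
    and "bounce b (of_real b - cis ((x + y - pi) / 2), pi / 2 + t) (mirror (cis (\<theta> - y), \<theta>))"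
proof -
  have "0 < cos t" "0 < sin \<theta>"
    using t \<theta> by (auto intro: cos_gt_zero_pi sin_gt_zero)
  note geo = crossing_geometry[OF b(1) \<open>0 < sin y\<close> this eq assms(9,10)]
  show pos: "b / 2 < cos (y - \<theta>)" by (rule geo(3))
  have "cos ((x + y - pi) / 2) = sin (y - t)"
  proof -
    have *: "(x + y - pi) / 2 = (y - t) - pi / 2" by (simp add: t_def field_simps)
    show ?thesis unfolding * cos_diff[of _ "pi / 2"] by simp
  qed
  then have pos': "b / 2 < cos ((x + y - pi) / 2)" using geo(2) by simp
  define T where "T = cos t + sin \<theta> - b * sin y"
  have "(x + y - pi) / 2 = y + (- t - pi / 2)" by (simp add: t_def field_simps)
  then have 1: "cis ((x + y - pi) / 2) = cis y * cis (- t - pi / 2)"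
    unfolding cis_mult by (rule arg_cong)
  have 2: "cis (y - \<theta>) = cis y * cis (- \<theta>)" by (simp add: cis_mult)
  have "cis (pi / 2 + t) * cis (- t - pi / 2) = 1" by (simp add: cis_mult)
  then have 3: "cis (pi / 2 + t) * (- \<i> * cis ((x + y - pi) / 2)) = - cis y * \<i>"
    unfolding 1 by algebra
  have 4: "cis y * cis (- y) = 1" by (simp add: cis_mult)
  have "of_real b * cis (- y) - cis (- t - pi / 2) - cis (- \<theta>) = of_real T * \<i>"
    using eq by (simp add: complex_eq_iff T_def cos_diff sin_diff)
  then have chord: "cis (y - \<theta>) - (of_real b - cis ((x + y - pi) / 2)) = of_real T * (- cis y * \<i>)"
    unfolding 1 2 using 4 by algebra
  have 5: "cis (pi - \<theta>) * (- cis y * \<i>) = \<i> * cis (y - \<theta>)"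
    unfolding 2 by (simp add: cis_pi_minus cis_cnj)
  have d1: "cis (y - \<theta>) - (of_real b - cis ((x + y - pi) / 2)) =
      of_real T * (cis (pi / 2 + t) * lemon_tangent b (of_real b - cis ((x + y - pi) / 2)))"
    unfolding left_arc_point(3)[OF b pos'] 3 by (rule chord)
  have d2: "cis (pi - \<theta>) * (cis (pi / 2 + t) * lemon_tangent b (of_real b - cis ((x + y - pi) / 2))) =
      lemon_tangent b (cis (y - \<theta>))"
    unfolding left_arc_point(3)[OF b pos'] right_arc_point(3)[OF b pos] 3 by (rule 5)
  have "mirror (cis (\<theta> - y), \<theta>) = (cis (y - \<theta>), pi - \<theta>)"
    by (simp add: mirror_def cis_cnj)
  then show "bounce b (of_real b - cis ((x + y - pi) / 2), pi / 2 + t) (mirror (cis (\<theta> - y), \<theta>))"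
    unfolding bounce_def lemon_phase_def
    using right_arc_point(1,2)[OF b pos] left_arc_point(1,2)[OF b pos'] d1 d2 geo(1) \<theta> t
    by (auto simp: T_def[symmetric] abs_less_iff)
qed


section \<open>Solving the equations of a coded orbit\<close>

text \<open>The box for the angles \<open>x\<close> and \<open>y\<close> of a slide with \<open>n\<close> bounces.  The bounds were found numerically:
  they are consistent with the worst case in which all slides of one parity sit at the upper and all
  slides of the other parity at the lower end of the box.\<close>

definition foot_min :: "nat \<Rightarrow> real" where
  "foot_min n = (if n = 4 then 820/1000 else 807/1000)"

definition foot_max :: "nat \<Rightarrow> real" where
  "foot_max n = (if n = 4 then 907/1000 else 893/1000)"

text \<open>The factor \<open>1/2\<close> in front of the defect of the equation makes the update monotone in \<open>z\<close>, since
  \<open>b \<le> 2\<close>.\<close>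

definition foot_update :: "real \<Rightarrow> nat \<Rightarrow> real \<Rightarrow> real \<Rightarrow> real \<Rightarrow> real" where
  "foot_update b n z p q = z + (b * cos z + sin ((z - q) / 2) - cos ((z + p) / (2 * real n))) / 2"

text \<open>The cosine is 1-Lipschitz, so \<open>b * cos z\<close> falls at most twice as fast as
  \<open>z\<close> grows. The sine term increases in \<open>z\<close> and decreases in
  \<open>q\<close>, and minus the last cosine increases in \<open>z + p\<close>.\<close>

lemma foot_update_mono:
  assumes "0 \<le> b" "b \<le> 2" "0 < n"
    and z: "0 \<le> z" "z \<le> z'" "z' \<le> 1" and p: "0 \<le> p" "p \<le> p'" "p' \<le> 1"
    and q: "0 \<le> q'" "q' \<le> q" "q \<le> 1"
  shows "foot_update b n z p q \<le> foot_update b n z' p' q'"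
proof -
  have "\<bar>cos z - cos z'\<bar> = 2 * (\<bar>sin ((z + z') / 2)\<bar> * \<bar>sin ((z' - z) / 2)\<bar>)"
    by (simp add: cos_diff_cos abs_mult)
  also have "\<dots> \<le> 2 * (1 * \<bar>(z' - z) / 2\<bar>)"
    by (intro mult_left_mono mult_mono abs_sin_le_one abs_sin_x_le_abs_x) auto
  finally have "\<bar>cos z - cos z'\<bar> \<le> z' - z" using z by simp
  moreover have "cos z' \<le> cos z"
    using z pi_gt3 by (intro cos_monotone_0_pi_le) auto
  ultimately have "b * (cos z - cos z') \<le> 2 * (z' - z)"
    using assms by (intro mult_mono) auto
  then have 1: "b * cos z - b * cos z' \<le> 2 * (z' - z)" by (simp add: algebra_simps)
  have 2: "sin ((z - q) / 2) \<le> sin ((z' - q') / 2)"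
    using z q pi_gt3 by (intro sin_monotone_2pi_le) auto
  have "(z + p) / (2 * real n) \<le> (z' + p') / (2 * real n)"
    using assms by (intro divide_right_mono) auto
  moreover have "(z' + p') / (2 * real n) \<le> 1"
    using assms by (simp add: divide_le_eq)
  then have "(z' + p') / (2 * real n) \<le> pi" using pi_gt3 by linarith
  ultimately have 3: "cos ((z' + p') / (2 * real n)) \<le> cos ((z + p) / (2 * real n))"
    using assms pi_gt3 by (intro cos_monotone_0_pi_le) auto
  show ?thesis unfolding foot_update_def using 1 2 3 by argo
qed

text \<open>By monotonicity only the extreme corners of the box matter. The neighbour
  \<open>q\<close> belongs to a slide of unknown length, hence the overall extremes 907/1000 and
  807/1000.\<close>

lemma foot_box:
  assumes b: "3/2 < b" "b < 3/2 + 1/10000" and n: "n = 4 \<or> n = 5"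
  shows "foot_min n \<le> foot_update b n (foot_min n) (foot_min n) (907/1000)"
    and "foot_update b n (foot_max n) (foot_max n) (807/1000) \<le> foot_max n"
proof -
  have lower: "3/2 * (1 - z^2/2 + z^4/24 - z^6/720 - z^8/40320) \<le> b * cos z"
    if "0 \<le> 1 - z^2/2 + z^4/24 - z^6/720 - z^8/40320" for z
    using b that cos_lower_8[of z] by (intro mult_mono) auto
  have upper: "b * cos z \<le> (3/2 + 1/10000) * (1 - z^2/2 + z^4/24 - z^6/720 + z^8/40320)"
    if "0 \<le> cos z" for z
    using b that cos_upper_8[of z] by (intro mult_mono) auto
  have c: "0 \<le> cos z" if "0 \<le> z" "z \<le> 1" for z :: real
    using that pi_gt3 by (intro cos_ge_zero) auto
  show "foot_min n \<le> foot_update b n (foot_min n) (foot_min n) (907/1000)"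
    using n
  proof
    assume "n = 4"
    then show ?thesis
      using lower[of "820/1000"] cos_upper_8[of "820/4000"] sin_x_le_x[of "87/2000"]
      by (simp add: foot_min_def foot_update_def power_divide)
  next
    assume "n = 5"
    then show ?thesis
      using lower[of "807/1000"] cos_upper_8[of "807/5000"] sin_x_le_x[of "1/20"]
      by (simp add: foot_min_def foot_update_def power_divide)
  qed
  show "foot_update b n (foot_max n) (foot_max n) (807/1000) \<le> foot_max n"
    using n
  proof
    assume "n = 4"
    then show ?thesis
      using upper[OF c, of "907/1000"] cos_lower_8[of "907/4000"] sin_x_le_x[of "1/20"]
      by (simp add: foot_max_def foot_update_def power_divide)
  next
    assume "n = 5"
    then show ?thesis
      using upper[OF c, of "893/1000"] cos_lower_8[of "893/5000"] sin_x_le_x[of "86/2000"]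
      by (simp add: foot_max_def foot_update_def power_divide)
  qed
qed

text \<open>At a fixed point of the simultaneous \<open>foot_update\<close> of all unknowns every
  defect vanishes, which gives the equations. Indexing slides by all integers avoids boundary
  conditions.\<close>

lemma feet_exist:
  fixes n :: "int \<Rightarrow> nat"
  assumes b: "3/2 < b" "b < 3/2 + 1/10000" and n: "\<And>k. n k = 4 \<or> n k = 5"
  shows "\<exists>x y :: int \<Rightarrow> real. \<forall>k. x k \<in> {foot_min (n k)..foot_max (n k)} \<and>
    y k \<in> {foot_min (n k)..foot_max (n k)} \<and>
    cos ((x k + y k) / (2 * real (n k))) = b * cos (x k) + sin ((x k - y (k + 1)) / 2) \<and>
    cos ((x k + y k) / (2 * real (n k))) = b * cos (y k) + sin ((y k - x (k - 1)) / 2)"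
proof -
  define lo where "lo = (\<lambda>(k, s::bool). foot_min (n k))"
  define hi where "hi = (\<lambda>(k, s::bool). foot_max (n k))"
  \<comment> \<open>The two unknowns of one slide share a sign, while a crossing couples slides of
    opposite sign; this turns the decrease of \<open>foot_update\<close> in \<open>q\<close> into an
    increase. In an index \<open>(k, s)\<close>, \<open>s\<close> selects \<open>x k\<close> when
    true and \<open>y k\<close> when false.\<close>
  define \<sigma> where "\<sigma> = (\<lambda>(k::int, s::bool). if even k then 1 else -1 :: real)"
  define T where "T u = (\<lambda>(k, s). foot_update b (n k) (u (k, s)) (u (k, \<not> s))
      (u (if s then k + 1 else k - 1, \<not> s)))" for u :: "int \<times> bool \<Rightarrow> real"
  have wide: "807/1000 \<le> lo i" "hi i \<le> 907/1000" "lo i \<le> hi i" for i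
    by (auto simp: lo_def hi_def foot_min_def foot_max_def split: prod.split)
  have "\<exists>u. (\<forall>i. lo i \<le> u i \<and> u i \<le> hi i) \<and> T u = u"
  proof (rule signed_monotone_fixpoint[where \<sigma> = \<sigma>])
    fix u :: "int \<times> bool \<Rightarrow> real" and i :: "int \<times> bool"
    assume u: "\<And>j. lo j \<le> u j \<and> u j \<le> hi j"
    obtain k s where i: "i = (k, s)" by force
    have u': "foot_min (n k) \<le> u (k, r)" "u (k, r) \<le> foot_max (n k)"
      "807/1000 \<le> u (k, r)" "u (k, r) \<le> 907/1000" for k :: int and r
      using u[of "(k, r)"] wide(1,2)[of "(k, r)"] by (auto simp: lo_def hi_def)
    have w: "807/1000 \<le> foot_min (n k)" "foot_max (n k) \<le> 907/1000"
      using wide(1,2)[of "(k, s)"] by (auto simp: lo_def hi_def)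
    have "0 < n k" using n[of k] by auto
    define q where "q = u (if s then k + 1 else k - 1, \<not> s)"
    have q: "807/1000 \<le> q" "q \<le> 907/1000" unfolding q_def by (rule u')+
    have "foot_min (n k) \<le> foot_update b (n k) (foot_min (n k)) (foot_min (n k)) (907/1000)"
      by (rule foot_box[OF b n])
    also have "\<dots> \<le> T u i"
      unfolding i T_def prod.case q_def[symmetric]
      using b u'[of k] q w \<open>0 < n k\<close> by (intro foot_update_mono) (auto intro: order_trans[of _ "907/1000"] order_trans[of _ "807/1000"])
    finally have 1: "lo i \<le> T u i" by (simp add: i lo_def)
    have "T u i \<le> foot_update b (n k) (foot_max (n k)) (foot_max (n k)) (807/1000)"
      unfolding i T_def prod.case q_def[symmetric]
      using b u'[of k] q w \<open>0 < n k\<close> by (intro foot_update_mono) (auto intro: order_trans[of _ "907/1000"] order_trans[of _ "807/1000"])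
    also have "\<dots> \<le> foot_max (n k)"
      by (rule foot_box[OF b n])
    finally show "lo i \<le> T u i \<and> T u i \<le> hi i" using 1 by (simp add: i hi_def)
  next
    fix u v :: "int \<times> bool \<Rightarrow> real" and i :: "int \<times> bool"
    assume u: "\<And>j. lo j \<le> u j \<and> u j \<le> hi j" and v: "\<And>j. lo j \<le> v j \<and> v j \<le> hi j"
      and le: "\<And>j. \<sigma> j * u j \<le> \<sigma> j * v j"
    obtain k s where i: "i = (k, s)" by force
    have r: "0 \<le> u j" "u j \<le> 1" "0 \<le> v j" "v j \<le> 1" for j
      using u[of j] v[of j] wide(1,2)[of j] by linarith+
    have "0 < n k" using n[of k] by auto
    show "\<sigma> i * T u i \<le> \<sigma> i * T v i"
      using le[of "(k, s)"] le[of "(k, \<not> s)"] le[of "(if s then k + 1 else k - 1, \<not> s)"] b \<open>0 < n k\<close>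
      by (cases "even k") (auto simp: i T_def \<sigma>_def intro!: foot_update_mono r)
  qed (use wide in \<open>auto simp: \<sigma>_def split: prod.split\<close>)
  then obtain u where u: "\<And>i. lo i \<le> u i \<and> u i \<le> hi i" "T u = u" by blast
  have eq: "b * cos (u (k, s)) + sin ((u (k, s) - u (if s then k + 1 else k - 1, \<not> s)) / 2) =
      cos ((u (k, s) + u (k, \<not> s)) / (2 * real (n k)))" for k s
    using fun_cong[OF u(2), of "(k, s)"] by (simp add: T_def foot_update_def)
  show ?thesis
    using u(1)[of "(_, True)"] u(1)[of "(_, False)"] eq[of _ True] eq[of _ False]
    by (intro exI[of _ "\<lambda>k. u (k, True)"] exI[of _ "\<lambda>k. u (k, False)"])
      (auto simp: lo_def hi_def add.commute)
qed


section \<open>Orbits with a prescribed code\<close>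

lemma foot_crossing_conditions:
  fixes z p q :: real
  assumes b: "3/2 < b" "b < 3/2 + 1/10000" and n: "n = 4 \<or> n = 5"
    and z: "z \<in> {foot_min n..foot_max n}" and p: "p \<in> {foot_min n..foot_max n}"
    and q: "807/1000 \<le> q" "q \<le> 907/1000"
  defines "\<theta> \<equiv> (z + p) / (2 * real n)" and "t \<equiv> (z - q) / 2"
  shows "0 < \<theta>" "\<theta> < pi" "\<bar>t\<bar> < pi / 2" "0 < sin z"
    "b\<^sup>2 / 2 - 1 < sin (\<theta> - t)" "1 - b\<^sup>2 / 2 < sin (\<theta> + t)"
proof -
  have zp: "807/1000 \<le> z" "z \<le> 907/1000" "807/1000 \<le> p" "p \<le> 907/1000"
    using z p by (auto simp: foot_min_def foot_max_def split: if_splits)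
  \<comment> \<open>The bound 127/1000 is attained for \<open>n = 5\<close>,
    \<open>z = 893/1000\<close>, \<open>p = q = 807/1000\<close>. It has to beat
    \<open>b\<^sup>2 / 2 - 1\<close>, which is 1/8 at \<open>b = 3/2\<close>.\<close>
  have "127/1000 \<le> \<theta> - t \<and> \<theta> - t \<le> 1 \<and> 0 \<le> \<theta> + t \<and> \<theta> + t \<le> 1 \<and> 0 < \<theta> \<and> \<theta> < 1"
    using n
  proof
    assume "n = 4"
    then show ?thesis
      using z p q unfolding \<theta>_def t_def by (simp add: foot_min_def foot_max_def) argo
  next
    assume "n = 5"
    then show ?thesis
      using z p q unfolding \<theta>_def t_def by (simp add: foot_min_def foot_max_def) argo
  qed
  then have \<theta>t: "127/1000 \<le> \<theta> - t" "\<theta> - t \<le> 1" "0 \<le> \<theta> + t" "\<theta> + t \<le> 1" "0 < \<theta>" "\<theta> < 1"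
    by blast+
  show "0 < \<theta>" "\<theta> < pi" using \<theta>t pi_gt3 by linarith+
  show "\<bar>t\<bar> < pi / 2" unfolding t_def abs_less_iff using zp q pi_gt3 by argo
  show "0 < sin z" using zp pi_gt3 by (intro sin_gt_zero) auto
  have b2: "(3/2)\<^sup>2 < b\<^sup>2" "b\<^sup>2 < (3/2 + 1/10000)\<^sup>2"
    using b by (simp_all add: power_strict_mono)
  then have "b\<^sup>2 / 2 - 1 < 127/1000 - (127/1000)^3 / 6"
    by (simp add: power2_eq_square power3_eq_cube)
  also have "\<dots> \<le> sin (127/1000)" by (rule sin_taylor_3) simp
  also have "\<dots> \<le> sin (\<theta> - t)" using \<theta>t pi_gt3 by (intro sin_monotone_2pi_le) auto
  finally show "b\<^sup>2 / 2 - 1 < sin (\<theta> - t)" .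
  have "0 \<le> sin (\<theta> + t)" using \<theta>t pi_gt3 by (intro sin_ge_zero) auto
  then show "1 - b\<^sup>2 / 2 < sin (\<theta> + t)" using b2 by (simp add: power2_eq_square)
qed

lemma cos_between_gt:
  fixes u v \<psi> :: real
  assumes "c < cos u" "c < cos v" "- u \<le> \<psi>" "\<psi> \<le> v" "u \<le> pi" "v \<le> pi"
  shows "c < cos \<psi>"
proof (cases "0 \<le> \<psi>")
  case True
  then have "cos v \<le> cos \<psi>" using assms by (intro cos_monotone_0_pi_le) auto
  then show ?thesis using assms by simp
next
  case False
  then have "cos u \<le> cos (- \<psi>)" using assms by (intro cos_monotone_0_pi_le) auto
  then show ?thesis using assms by simp
qed

locale coded_orbit =
  fixes b :: real and n :: "int \<Rightarrow> nat" and x y :: "int \<Rightarrow> real"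
  assumes b: "3/2 < b" "b < 3/2 + 1/10000"
    and n: "\<And>k. n k = 4 \<or> n k = 5"
    and x: "\<And>k. x k \<in> {foot_min (n k)..foot_max (n k)}"
    and y: "\<And>k. y k \<in> {foot_min (n k)..foot_max (n k)}"
    and exit_eq: "\<And>k. cos ((x k + y k) / (2 * real (n k))) = b * cos (x k) + sin ((x k - y (k + 1)) / 2)"
    and enter_eq: "\<And>k. cos ((x k + y k) / (2 * real (n k))) = b * cos (y k) + sin ((y k - x (k - 1)) / 2)"
begin

definition angle :: "int \<Rightarrow> real" where
  "angle k = (x k + y k) / (2 * real (n k))"

text \<open>Every slide is recorded as running counterclockwise on the right arc; in the actual
  orbit every second slide appears mirrored.\<close>

definition right_state :: "int \<Rightarrow> nat \<Rightarrow> complex \<times> real" where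
  "right_state k j = (cis (angle k - y k + 2 * real j * angle k), angle k)"

definition left_state :: "int \<Rightarrow> complex \<times> real" where
  "left_state k = (of_real b - cis ((x k + y (k + 1) - pi) / 2), pi / 2 - (x k - y (k + 1)) / 2)"

lemma b_bounds: "0 < b" "b < 2"
  using b by auto

lemma foot_wide: "807/1000 \<le> x k" "x k \<le> 907/1000" "807/1000 \<le> y k" "y k \<le> 907/1000"
  using x[of k] y[of k] by (auto simp: foot_min_def foot_max_def split: if_splits)

lemma angle_bounds: "0 < angle k" "angle k < pi"
  using foot_crossing_conditions(1,2)[OF b n[of k] x[of k] y[of k] foot_wide(1,2)[of k]]
  unfolding angle_def by blast+

lemma total_turn: "x k + y k = 2 * real (n k) * angle k"
  using n[of k] by (auto simp: angle_def)

lemma exit_bounce: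
  "b / 2 < cos (x k - angle k)"
  "bounce b (cis (x k - angle k), angle k) (left_state k)"
  using bounce_exit[OF b_bounds, of "angle k" "x k" "y (k + 1)"]
    foot_crossing_conditions[OF b n[of k] x[of k] y[of k] foot_wide(3,4)[of "k + 1"]] exit_eq[of k]
  by (auto simp: left_state_def angle_def)

lemma enter_bounce:
  "b / 2 < cos (y k - angle k)"
  "bounce b (left_state (k - 1)) (mirror (right_state k 0))"
proof -
  have left: "left_state (k - 1) =
      (of_real b - cis ((x (k - 1) + y k - pi) / 2), pi / 2 + (y k - x (k - 1)) / 2)"
    by (simp add: left_state_def diff_divide_distrib)
  show "b / 2 < cos (y k - angle k)" "bounce b (left_state (k - 1)) (mirror (right_state k 0))"
    unfolding left
    using bounce_enter[OF b_bounds, of "angle k" "y k" "x (k - 1)"]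
      foot_crossing_conditions[OF b n[of k] y[of k] x[of k] foot_wide(1,2)[of "k - 1"]] enter_eq[of k]
    by (auto simp: right_state_def angle_def add.commute[of "y k"])
qed

text \<open>The crossings place the first and the last point of a slide on the open right arc; the
  other points lie between them.\<close>

lemma right_position:
  assumes "j < n k"
  shows "b / 2 < cos (angle k - y k + 2 * real j * angle k)"
proof (rule cos_between_gt[OF enter_bounce(1)[of k] exit_bounce(1)[of k]])
  show "- (y k - angle k) \<le> angle k - y k + 2 * real j * angle k"
    using angle_bounds[of k] by simp
  have "real j + 1 \<le> real (n k)" using assms by linarith
  then have "(real j + 1) * angle k \<le> real (n k) * angle k"
    using angle_bounds[of k] by (intro mult_right_mono) auto
  then show "angle k - y k + 2 * real j * angle k \<le> x k - angle k"
    using total_turn[of k] by (simp add: algebra_simps)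
qed (use angle_bounds[of k] foot_wide[of k] pi_gt3 in linarith)+

lemma slide_bounce:
  assumes "Suc j < n k"
  shows "bounce b (right_state k j) (right_state k (Suc j))"
  using bounce_slide[OF b_bounds angle_bounds[of k], of "angle k - y k + 2 * real j * angle k"]
    right_position[of j k] right_position[of "Suc j" k] assms
  by (simp add: right_state_def algebra_simps)

lemma leave_bounce: "bounce b (right_state k (n k - 1)) (left_state k)"
proof -
  have "real (n k - 1) = real (n k) - 1" using n[of k] by auto
  then have "angle k - y k + 2 * real (n k - 1) * angle k = x k - angle k"
    using total_turn[of k] by (simp add: algebra_simps)
  then show ?thesis unfolding right_state_def using exit_bounce(2)[of k] by (simp only:)
qed

section \<open>Invariance and block structure of the coded orbit\<close>

definition orbit_states :: "(complex \<times> real) set" where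
  "orbit_states = {right_state k j | k j. j < n k} \<union> range left_state"

text \<open>Each return from the left arc passes to a mirrored state, so only the union with the
  mirror images is closed under the dynamics. Since \<open>bounce\<close> excludes corners, such
  orbits never meet one.\<close>

lemma orbit_states_step:
  assumes "P \<in> orbit_states \<union> mirror ` orbit_states"
  shows "\<exists>Q \<in> orbit_states \<union> mirror ` orbit_states. bounce b P Q"
proof -
  have step: "\<exists>Q \<in> orbit_states \<union> mirror ` orbit_states. bounce b P Q" if P: "P \<in> orbit_states" for P
  proof -
    consider k j where "P = right_state k j" "j < n k" | k where "P = left_state k"
      using P unfolding orbit_states_def by blast
    then show ?thesis
    proof cases
      case (1 k j)
      show ?thesis
      proof (cases "Suc j < n k")
        case True
        then show ?thesis using slide_bounce 1 by (force simp: orbit_states_def)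
      next
        case False
        then have "j = n k - 1" using 1 by simp
        then show ?thesis using leave_bounce 1 by (force simp: orbit_states_def)
      qed
    next
      case (2 k)
      have "0 < n (k + 1)" using n[of "k + 1"] by auto
      then have "right_state (k + 1) 0 \<in> orbit_states" by (auto simp: orbit_states_def)
      then show ?thesis using enter_bounce(2)[of "k + 1"] 2 by auto
    qed
  qed
  show ?thesis
  proof (cases "P \<in> orbit_states")
    case False
    then obtain P' where P: "P = mirror P'" "P' \<in> orbit_states" using assms by auto
    then obtain Q where Q: "Q \<in> orbit_states \<union> mirror ` orbit_states" "bounce b P' Q" using step by blast
    then have "mirror Q \<in> orbit_states \<union> mirror ` orbit_states" by auto
    then show ?thesis using bounce_mirror[OF b_bounds Q(2)] P by auto
  qed (rule step)
qed

lemma right_state_in_domain: "right_state k 0 \<in> lemon_domain b"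
proof -
  define S where "S = orbit_states \<union> mirror ` orbit_states"
  have ok: "P \<in> lemon_phase b \<and> fst P \<notin> lemon_corners b \<and> lemon_map b P \<in> S" if "P \<in> S" for P
    using orbit_states_step[of P] that bounce_imp_lemon_map[OF b_bounds]
    by (fold S_def) (metis bounce_def)
  have "0 < n k" using n[of k] by auto
  then have "right_state k 0 \<in> S" by (auto simp: S_def orbit_states_def)
  moreover from this have "(lemon_map b ^^ m) (right_state k 0) \<in> S" for m
    by (induction m) (use ok in auto)
  ultimately show ?thesis using ok by (simp add: lemon_domain_def)
qed

text \<open>A block consists of \<open>n k - 1\<close> chords along the arc, one crossing and one
  return.\<close>

lemma block_iterate: "(lemon_map b ^^ Suc (n k)) (right_state k 0) = mirror (right_state (k + 1) 0)"
proof -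
  have "(lemon_map b ^^ j) (right_state k 0) = right_state k j" if "j < n k" for j
    using that bounce_imp_lemon_map[OF b_bounds slide_bounce]
    by (induction j) auto
  moreover obtain m where m: "n k = Suc m" using n[of k] by auto
  ultimately have "(lemon_map b ^^ n k) (right_state k 0) = left_state k"
    using bounce_imp_lemon_map[OF b_bounds leave_bounce[of k]] by simp
  then show ?thesis
    using bounce_imp_lemon_map[OF b_bounds enter_bounce(2)[of "k + 1"]] by simp
qed

text \<open>The billiard map commutes with \<open>mirror\<close> along the states of the
  orbit.\<close>

lemma block_iterate_mirror:
  "(lemon_map b ^^ Suc (n k)) (mirror (right_state k 0)) = right_state (k + 1) 0"
proof -
  have "(lemon_map b ^^ m) (mirror P) = mirror ((lemon_map b ^^ m) P)"
    if "P \<in> orbit_states \<union> mirror ` orbit_states" for P m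
    using that
  proof (induction m arbitrary: P)
    case (Suc m)
    obtain Q where Q: "Q \<in> orbit_states \<union> mirror ` orbit_states" "bounce b P Q"
      using orbit_states_step[OF Suc.prems] by blast
    then have "lemon_map b P = Q" "lemon_map b (mirror P) = mirror Q"
      using bounce_imp_lemon_map[OF b_bounds] bounce_mirror[OF b_bounds] by blast+
    then show ?case using Suc.IH[OF Q(1)] by (simp add: funpow_Suc_right del: funpow.simps)
  qed simp
  moreover have "right_state k 0 \<in> orbit_states" using n[of k] by (force simp: orbit_states_def)
  ultimately have "(lemon_map b ^^ Suc (n k)) (mirror (right_state k 0)) =
      mirror ((lemon_map b ^^ Suc (n k)) (right_state k 0))"
    by blast
  then show ?thesis unfolding block_iterate by simp
qed

section \<open>Reading the code off the orbit\<close>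

definition block_start :: "nat \<Rightarrow> nat" where
  "block_start m = (\<Sum>i<m. Suc (n (int i)))"

lemma orbit_at_block_start:
  "(lemon_map b ^^ block_start m) (right_state 0 0) =
    (if even m then right_state (int m) 0 else mirror (right_state (int m) 0))"
proof (induction m)
  case 0
  then show ?case by (simp add: block_start_def)
next
  case (Suc m)
  have "block_start (Suc m) = Suc (n (int m)) + block_start m" by (simp add: block_start_def)
  then have "(lemon_map b ^^ block_start (Suc m)) (right_state 0 0) =
      (lemon_map b ^^ Suc (n (int m))) ((lemon_map b ^^ block_start m) (right_state 0 0))"
    by (simp only: funpow_add o_apply)
  then show ?case
    using Suc.IH block_iterate[of "int m"] block_iterate_mirror[of "int m"] by (simp add: add.commute)
qed

lemma angle_at_block_start:
  "snd ((lemon_map b ^^ block_start m) (right_state 0 0)) =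
    (if even m then angle (int m) else pi - angle (int m))"
  unfolding orbit_at_block_start by (simp add: mirror_def right_state_def)

text \<open>The ends of the boxes give 820/4000 and 893/5000. The gap left between the two ranges is
  26/1000, more than the separation scale 1/50 used below.\<close>

lemma angle_range: "n k = 4 \<Longrightarrow> 205/1000 \<le> angle k" "n k = 5 \<Longrightarrow> angle k \<le> 179/1000"
  using x[of k] y[of k] by (auto simp: angle_def foot_min_def foot_max_def)

end


section \<open>Positive entropy\<close>

lemma topological_entropy_pos:
  fixes F :: "'a::metric_space \<Rightarrow> 'a"
  assumes "0 < \<epsilon>" "0 < N"
    and sep: "\<And>m n. N * m \<le> n \<Longrightarrow> \<exists>E. separated_set F X n \<epsilon> E \<and> 2 ^ m \<le> card E"
  shows "0 < topological_entropy F X"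
proof -
  define h where "h n = (SUP E\<in>{E. separated_set F X n \<epsilon> E}. ereal (ln (real (card E)) / real n))" for n
  \<comment> \<open>For \<open>n \<ge> N\<close> and \<open>m = n div N\<close> one has
    \<open>n \<le> 2 * N * m\<close>; the factor 2 absorbs this rounding.\<close>
  define c where "c = ln 2 / (2 * real N)"
  have "ereal c \<le> h n" if "N \<le> n" for n
  proof -
    define m where "m = n div N"
    obtain E where E: "separated_set F X n \<epsilon> E" "2 ^ m \<le> card E"
      using sep[of m n] by (auto simp: m_def)
    have "n = N * m + n mod N" by (simp add: m_def)
    moreover have "n mod N < N" using \<open>0 < N\<close> by simp
    moreover have "0 < m" unfolding m_def using \<open>0 < N\<close> that by (simp add: div_greater_zero_iff)
    then have "N * 1 \<le> N * m" by (intro mult_le_mono2) simp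
    ultimately have "n \<le> 2 * N * m" by linarith
    then have "real n \<le> real (2 * N * m)" by (rule of_nat_mono)
    then have "real n * c \<le> 2 * real N * real m * c"
      unfolding c_def by (intro mult_right_mono) auto
    also have "\<dots> = real m * ln 2" using \<open>0 < N\<close> by (simp add: c_def)
    also have "\<dots> = ln (2 ^ m)" by (simp add: ln_realpow)
    also have "\<dots> \<le> ln (real (card E))"
    proof (rule ln_mono)
      have "real (2 ^ m) \<le> real (card E)" using E(2) by (rule of_nat_mono)
      then show "2 ^ m \<le> real (card E)" by simp
    qed simp
    finally have "c \<le> ln (real (card E)) / real n"
      using that \<open>0 < N\<close> by (simp add: le_divide_eq mult.commute)
    also have "ereal \<dots> \<le> h n"
      unfolding h_def using E by (intro SUP_upper) auto
    finally show ?thesis by simp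
  qed
  then have "eventually (\<lambda>n. ereal c \<le> h n) sequentially"
    by (rule eventually_sequentiallyI)
  then have "ereal c \<le> liminf h" by (rule Liminf_bounded)
  also have "\<dots> \<le> limsup h" by (intro Liminf_le_Limsup) simp
  also have "\<dots> \<le> topological_entropy F X"
    unfolding topological_entropy_def h_def using \<open>0 < \<epsilon>\<close> by (intro SUP_upper) simp
  finally have "ereal c \<le> topological_entropy F X" .
  moreover have "0 < ereal c" using \<open>0 < N\<close> by (simp add: c_def)
  ultimately show ?thesis by (rule less_le_trans[rotated])
qed

text \<open>A code is the set \<open>S\<close> of the blocks with four bounces. A block takes one
  step more than its number of bounces on the right arc, hence 5 and 6.\<close>

definition code_time :: "nat set \<Rightarrow> nat \<Rightarrow> nat" where
  "code_time S m = (\<Sum>i<m. if i \<in> S then 5 else 6)"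

lemma code_time_le: "code_time S m \<le> 6 * m"
proof -
  have "code_time S m \<le> (\<Sum>i<m. 6)" unfolding code_time_def by (intro sum_mono) auto
  then show ?thesis by simp
qed

lemma coded_point_exists:
  assumes b: "3/2 < b" "b < 3/2 + 1/10000"
  shows "\<exists>p \<in> lemon_domain b. \<forall>m. \<exists>a. snd ((lemon_map b ^^ code_time S m) p) = (if even m then a else pi - a) \<and>
    (if m \<in> S then 205/1000 \<le> a else a \<le> 179/1000)"
proof -
  \<comment> \<open>As \<open>nat k\<close> is 0 for negative \<open>k\<close>, the past repeats the
    symbol of block 0; the forward orbit visits only blocks with \<open>k \<ge> 0\<close>.\<close>
  define n :: "int \<Rightarrow> nat" where "n k = (if nat k \<in> S then 4 else 5)" for k
  have n: "n k = 4 \<or> n k = 5" for k by (simp add: n_def)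
  obtain x y where "\<forall>k. x k \<in> {foot_min (n k)..foot_max (n k)} \<and>
    y k \<in> {foot_min (n k)..foot_max (n k)} \<and>
    cos ((x k + y k) / (2 * real (n k))) = b * cos (x k) + sin ((x k - y (k + 1)) / 2) \<and>
    cos ((x k + y k) / (2 * real (n k))) = b * cos (y k) + sin ((y k - x (k - 1)) / 2)"
    using feet_exist[of b n, OF b n] by blast
  then interpret coded_orbit b n x y
    using b n by unfold_locales blast+
  have time: "block_start m = code_time S m" for m
    unfolding block_start_def code_time_def by (intro sum.cong) (auto simp: n_def)
  show ?thesis
  proof (intro bexI[OF _ right_state_in_domain[of 0]] allI)
    fix m
    show "\<exists>a. snd ((lemon_map b ^^ code_time S m) (right_state 0 0)) = (if even m then a else pi - a) \<and>
        (if m \<in> S then 205/1000 \<le> a else a \<le> 179/1000)"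
      using angle_at_block_start[of m] angle_range[of "int m"]
      by (intro exI[of _ "angle (int m)"]) (simp add: time n_def split: if_splits)
  qed
qed

text \<open>The \<open>2 ^ m\<close> subsets of \<open>{..<m}\<close> serve as codes. Blocks differ
  in length, so two orbits are compared at their first differing block, which both reach at the same
  time; the angles there differ by more than 1/50.\<close>

lemma lemon_separated_sets:
  assumes b: "3/2 < b" "b < 3/2 + 1/10000" and "6 * m \<le> n"
  shows "\<exists>E. separated_set (lemon_map b) (lemon_domain b) n (1/50) E \<and> 2 ^ m \<le> card E"
proof -
  obtain p where p: "\<And>S. p S \<in> lemon_domain b" and
    angle: "\<And>S k. \<exists>a. snd ((lemon_map b ^^ code_time S k) (p S)) = (if even k then a else pi - a) \<and>
      (if k \<in> S then 205/1000 \<le> a else a \<le> 179/1000)"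
    using coded_point_exists[OF b] by metis
  have sep: "\<exists>k<n. dist ((lemon_map b ^^ k) (p S)) ((lemon_map b ^^ k) (p S')) > 1/50"
    if S: "S \<subseteq> {..<m}" "S' \<subseteq> {..<m}" "S \<noteq> S'" for S S'
  proof -
    define k where "k = (LEAST k. (k \<in> S) \<noteq> (k \<in> S'))"
    have "\<exists>k. (k \<in> S) \<noteq> (k \<in> S')" using S(3) by blast
    then have k: "(k \<in> S) \<noteq> (k \<in> S')" unfolding k_def by (rule LeastI_ex)
    have agree: "(i \<in> S) = (i \<in> S')" if "i < k" for i
      using not_less_Least[of i "\<lambda>k. (k \<in> S) \<noteq> (k \<in> S')"] that unfolding k_def by blast
    have "code_time S k = code_time S' k"
      unfolding code_time_def by (intro sum.cong) (auto simp: agree)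
    then have "1/50 < \<bar>snd ((lemon_map b ^^ code_time S k) (p S)) - snd ((lemon_map b ^^ code_time S k) (p S'))\<bar>"
      using angle[of S k] angle[of S' k] k by (auto simp: abs_if split: if_splits)
    also have "\<dots> \<le> dist ((lemon_map b ^^ code_time S k) (p S)) ((lemon_map b ^^ code_time S k) (p S'))"
      using dist_snd_le by (simp add: dist_real_def[symmetric])
    finally have "1/50 < dist ((lemon_map b ^^ code_time S k) (p S)) ((lemon_map b ^^ code_time S k) (p S'))" .
    moreover have "k < m" using k S by auto
    then have "code_time S k < n" using code_time_le[of S k] assms(3) by linarith
    ultimately show ?thesis by blast
  qed
  have inj: "inj_on p (Pow {..<m})"
  proof (rule inj_onI)
    fix S S' assume "S \<in> Pow {..<m}" "S' \<in> Pow {..<m}" "p S = p S'"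
    then show "S = S'" using sep[of S S'] by force
  qed
  have "separated_set (lemon_map b) (lemon_domain b) n (1/50) (p ` Pow {..<m})"
    unfolding separated_set_def
  proof (intro conjI ballI impI)
    fix P P' assume "P \<in> p ` Pow {..<m}" "P' \<in> p ` Pow {..<m}" "P \<noteq> P'"
    then obtain S S' where "S \<subseteq> {..<m}" "S' \<subseteq> {..<m}" "P = p S" "P' = p S'" "S \<noteq> S'" by blast
    then show "\<exists>k<n. 1/50 < dist ((lemon_map b ^^ k) P) ((lemon_map b ^^ k) P')"
      using sep[of S S'] by simp
  qed (use p in auto)
  moreover have "card (p ` Pow {..<m}) = 2 ^ m"
    using inj by (simp add: card_image card_Pow)
  ultimately show ?thesis by (metis order_refl)
qed

theorem theorem1p2:
  shows "\<exists>\<delta>\<^sub>0::real. 0 < \<delta>\<^sub>0 \<and> 3/2 + \<delta>\<^sub>0 \<le> 2 \<and>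
    (\<forall>b\<^sub>0\<in>{3/2<..<3/2 + \<delta>\<^sub>0}.
       \<not> b\<^sub>0 islimpt {b \<in> {3/2<..<3/2 + \<delta>\<^sub>0}. lemon_entropy b = 0})"
proof -
  have "0 < lemon_entropy b" if "3/2 < b" "b < 3/2 + 1/10000" for b
    unfolding lemon_entropy_def
    \<comment> \<open>A block takes at most 6 steps.\<close>
    by (rule topological_entropy_pos[of "1/50" 6]) (auto intro: lemon_separated_sets[OF that])
  then have no_zero: "{b \<in> {3/2<..<3/2 + 1/10000}. lemon_entropy b = 0} = {}" by force
  show ?thesis
    by (intro exI[of _ "1/10000 :: real"]) (simp only: no_zero islimpt_EMPTY not_False_eq_True ball_simps, simp)
qed


end
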